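(* The Algebraic Separation Hypothesis is equivalent to the Number-Theoretic Hypothesis. Moreover, the Compact Separation Hypothesis is equivalent to the Number-Theoretic Hypothesis restricted to $v_1,\dots,v_n$ satisfying $|v_1|=\dots=|v_n|=1$.
   Context: Let $M=(M_{ij})\in\mathbb{Z}^{d\times n}$; $T=(\mathbb{C}^\times)^d$ acts on $\mathbb{C}^n$ by $t\cdot v=\big(v_j\prod_{i=1}^d t_i^{M_{ij}}\big)_{j=1}^n$, $K=(S^1)^d\subset T$ acts by restriction; $\mathcal{O}_v=T\cdot v$, $\mathcal{C}_v=K\cdot v$. $\mathrm{dist}$ is Euclidean distance (infimum for sets). $\mathrm{Log}$ is the componentwise logarithm $(\mathbb{C}^\times)^n\to\mathbb{C}^n/2\pi i\mathbb{Z}^n$ and $\delta_{\log}(v,w)=\min_{\alpha\in2\pi i\mathbb{Z}^n}\|\mathrm{Log}\,v-\mathrm{Log}\,w-\alpha\|$, extended to sets by infimum. Define $\mathrm{sep}_K(d,n,B,b)=\min\mathrm{dist}(\mathcal{C}_v,\mathcal{C}_w)$ and $\mathrm{sep}_T(d,n,B,b)=\min\delta_{\log}(\mathcal{O}_v,\mathcal{O}_w)$, the minima over all $M\in\mathbb{Z}^{d\times n}$ whose entries have bit-length at most $B$ and all $v,w\in(\mathbb{Q}(i)^\times)^n$ whose components have bit-length at most $b$ and which lie in distinct orbits ($K$-orbits resp. $T$-orbits). Compact Separation Hypothesis: there is a polynomial $p$ with $\mathrm{sep}_K(d,n,B,b)\ge\exp(-p(d,n,b,B))$ for all $d,n,B,b$.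 Algebraic Separation Hypothesis: there is a polynomial $p$ with $\mathrm{sep}_T(d,n,B,b)\ge\exp(-p(d,n,b,B))$. Number-Theoretic Hypothesis: there is a polynomial $p$ such that for all $n\ge0$, $v_1,\dots,v_n\in\mathbb{Q}(i)^\times$ and $e_1,\dots,e_n\in\mathbb{Z}$ with $\Lambda(v,e):=e_1\mathrm{Log}\,v_1+\dots+e_n\mathrm{Log}\,v_n\ne0$ (principal branch of the complex logarithm), one has $|\Lambda(v,e)|\ge\exp(-p(n,b,B))$, where $B$, $b$ are the maximum bit-lengths of the $e_j$ and the $v_j$. *)

theory Defs
  imports "HOL-Analysis.Analysis" "HOL-Library.Log_Nat" "HOL-Library.Poly_Mapping"
begin

text \<open>
  Vectors in \<open>\<complex>\<^sup>n\<close> are functions on the index set \<open>{..<n}\<close> (undefined elsewhere, so that equality of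
  vectors and of orbits is the intended one). Of a matrix \<open>M :: nat \<Rightarrow> nat \<Rightarrow> int\<close> only the entries
  \<open>M i j\<close> with \<open>i < d\<close> and \<open>j < n\<close> are ever used.
\<close>

definition torus :: "nat \<Rightarrow> (nat \<Rightarrow> complex) set" where
  "torus d = {..<d} \<rightarrow>\<^sub>E (UNIV - {0})"

definition compact_torus :: "nat \<Rightarrow> (nat \<Rightarrow> complex) set" where
  "compact_torus d = {..<d} \<rightarrow>\<^sub>E sphere 0 1"

definition torus_act ::
  "nat \<Rightarrow> nat \<Rightarrow> (nat \<Rightarrow> nat \<Rightarrow> int) \<Rightarrow> (nat \<Rightarrow> complex) \<Rightarrow> (nat \<Rightarrow> complex) \<Rightarrow> nat \<Rightarrow> complex" where
  "torus_act d n M t v = (\<lambda>j\<in>{..<n}. v j * (\<Prod>i<d. t i powi M i j))"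

definition orbit_T ::
  "nat \<Rightarrow> nat \<Rightarrow> (nat \<Rightarrow> nat \<Rightarrow> int) \<Rightarrow> (nat \<Rightarrow> complex) \<Rightarrow> (nat \<Rightarrow> complex) set" where
  "orbit_T d n M v = (\<lambda>t. torus_act d n M t v) ` torus d"

definition orbit_K ::
  "nat \<Rightarrow> nat \<Rightarrow> (nat \<Rightarrow> nat \<Rightarrow> int) \<Rightarrow> (nat \<Rightarrow> complex) \<Rightarrow> (nat \<Rightarrow> complex) set" where
  "orbit_K d n M v = (\<lambda>t. torus_act d n M t v) ` compact_torus d"

definition euclid_dist :: "nat \<Rightarrow> (nat \<Rightarrow> complex) \<Rightarrow> (nat \<Rightarrow> complex) \<Rightarrow> real" where
  "euclid_dist n v w = L2_set (\<lambda>j. cmod (v j - w j)) {..<n}"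

text \<open>
  The class of \<open>Log v\<close> modulo \<open>2\<pi>i\<int>\<^sup>n\<close> is represented by the principal logarithms; the value does not
  depend on the representative, and the infimum is attained because \<open>2\<pi>i\<int>\<^sup>n\<close> is closed and discrete.
\<close>

definition log_dist :: "nat \<Rightarrow> (nat \<Rightarrow> complex) \<Rightarrow> (nat \<Rightarrow> complex) \<Rightarrow> real" where
  "log_dist n v w =
    (INF k\<in>(UNIV :: (nat \<Rightarrow> int) set).
       L2_set (\<lambda>j. cmod (Ln (v j) - Ln (w j) - 2 * of_real pi * \<i> * of_int (k j))) {..<n})"

definition set_dist :: "('a \<Rightarrow> 'a \<Rightarrow> real) \<Rightarrow> 'a set \<Rightarrow> 'a set \<Rightarrow> real" where
  "set_dist \<delta> X Y = (INF (x, y)\<in>X \<times> Y. \<delta> x y)"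

text \<open>
  Binary encoding lengths: an integer needs a sign bit and its binary digits, a rational is encoded by
  its reduced fraction with one sign bit, a Gaussian rational by its real and imaginary part.
  (The library function \<^const>\<open>bitlen\<close> is 0 on negative arguments, hence the absolute values.)
\<close>

definition int_bits :: "int \<Rightarrow> nat" where
  "int_bits k = 1 + nat (bitlen \<bar>k\<bar>)"

definition rat_bits :: "rat \<Rightarrow> nat" where
  "rat_bits q = (case quotient_of q of (a, c) \<Rightarrow> 1 + nat (bitlen \<bar>a\<bar>) + nat (bitlen c))"

definition gauss_rats :: "complex set" where
  "gauss_rats = {z. Re z \<in> \<rat> \<and> Im z \<in> \<rat>}"

definition gauss_bits :: "complex \<Rightarrow> nat" where
  "gauss_bits z = rat_bits (the_inv of_rat (Re z)) + rat_bits (the_inv of_rat (Im z))"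

definition int_mats :: "nat \<Rightarrow> nat \<Rightarrow> nat \<Rightarrow> (nat \<Rightarrow> nat \<Rightarrow> int) set" where
  "int_mats d n B = {M. \<forall>i<d. \<forall>j<n. int_bits (M i j) \<le> B}"

definition gauss_vecs :: "nat \<Rightarrow> nat \<Rightarrow> (nat \<Rightarrow> complex) set" where
  "gauss_vecs n b = {..<n} \<rightarrow>\<^sub>E {z \<in> gauss_rats - {0}. gauss_bits z \<le> b}"

text \<open>
  Only finitely many values compete in the following infima, so they are minima; when no instance
  exists the value is \<open>\<infinity>\<close>.
\<close>

definition sep_K :: "nat \<Rightarrow> nat \<Rightarrow> nat \<Rightarrow> nat \<Rightarrow> ereal" where
  "sep_K d n B b =
    (INF (M, v, w)\<in>{(M, v, w). M \<in> int_mats d n B \<and> v \<in> gauss_vecs n b \<and> w \<in> gauss_vecs n b \<and>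
                              orbit_K d n M v \<noteq> orbit_K d n M w}.
       ereal (set_dist (euclid_dist n) (orbit_K d n M v) (orbit_K d n M w)))"

definition sep_T :: "nat \<Rightarrow> nat \<Rightarrow> nat \<Rightarrow> nat \<Rightarrow> ereal" where
  "sep_T d n B b =
    (INF (M, v, w)\<in>{(M, v, w). M \<in> int_mats d n B \<and> v \<in> gauss_vecs n b \<and> w \<in> gauss_vecs n b \<and>
                              orbit_T d n M v \<noteq> orbit_T d n M w}.
       ereal (set_dist (log_dist n) (orbit_T d n M v) (orbit_T d n M w)))"

text \<open>
  Real polynomials in three and four variables, given by their finitely supported families of
  coefficients indexed by exponent tuples, and evaluated at natural numbers.
\<close>

definition eval3 :: "(nat \<times> nat \<times> nat \<Rightarrow>\<^sub>0 real) \<Rightarrow> nat \<Rightarrow> nat \<Rightarrow> nat \<Rightarrow> real" where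
  "eval3 p x y z =
    (\<Sum>(i, j, k)\<in>Poly_Mapping.keys p. Poly_Mapping.lookup p (i, j, k) * real x ^ i * real y ^ j * real z ^ k)"

definition eval4 :: "(nat \<times> nat \<times> nat \<times> nat \<Rightarrow>\<^sub>0 real) \<Rightarrow> nat \<Rightarrow> nat \<Rightarrow> nat \<Rightarrow> nat \<Rightarrow> real" where
  "eval4 p x y z u =
    (\<Sum>(i, j, k, l)\<in>Poly_Mapping.keys p.
       Poly_Mapping.lookup p (i, j, k, l) * real x ^ i * real y ^ j * real z ^ k * real u ^ l)"

definition compact_separation_hypothesis :: bool where
  "compact_separation_hypothesis \<longleftrightarrow>
    (\<exists>p. \<forall>d n B b. sep_K d n B b \<ge> ereal (exp (- eval4 p d n b B)))"

definition algebraic_separation_hypothesis :: bool where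
  "algebraic_separation_hypothesis \<longleftrightarrow>
    (\<exists>p. \<forall>d n B b. sep_T d n B b \<ge> ereal (exp (- eval4 p d n b B)))"

definition log_form :: "nat \<Rightarrow> (nat \<Rightarrow> complex) \<Rightarrow> (nat \<Rightarrow> int) \<Rightarrow> complex" where
  "log_form n v e = (\<Sum>j<n. of_int (e j) * Ln (v j))"

text \<open>
  The hypothesis with all \<open>v j\<close> restricted to \<open>A\<close>. For \<open>n = 0\<close>, where the maxima are unspecified, the
  linear form vanishes and nothing is claimed.
\<close>

definition number_theoretic_hypothesis_on :: "complex set \<Rightarrow> bool" where
  "number_theoretic_hypothesis_on A \<longleftrightarrow>
    (\<exists>p. \<forall>n v e. (\<forall>j<n. v j \<in> gauss_rats - {0} \<and> v j \<in> A) \<longrightarrow> log_form n v e \<noteq> 0 \<longrightarrow>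
       cmod (log_form n v e) \<ge>
         exp (- eval3 p n (Max ((\<lambda>j. gauss_bits (v j)) ` {..<n})) (Max ((\<lambda>j. int_bits (e j)) ` {..<n}))))"

definition number_theoretic_hypothesis :: bool where
  "number_theoretic_hypothesis \<longleftrightarrow> number_theoretic_hypothesis_on UNIV"

end

theory Submission
  imports Defs "Jordan_Normal_Form.Determinant"
begin

text \<open>
  Two orbits are separated by a linear form in logarithms. Passing to logarithms, \<open>v\<close> and \<open>w\<close> lie in the
  same \<open>T\<close>-orbit iff \<open>Log v - Log w\<close> lies in the row space of \<open>M\<close> up to \<open>2\<pi>i\<int>\<^sup>n\<close>. If no branch does, then
  for each branch \<open>x\<close> an integer vector \<open>h\<close> with \<open>M h = 0\<close> and entries of polynomial bit-length (by
  Cramer's rule) satisfies \<open>\<langle>h, x\<rangle> \<noteq> 0\<close>. This number is an integer linear form in logarithms of Gaussian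
  rationals, with \<open>Ln (-1)\<close> taking care of the branches, and it bounds the distance of the orbits from
  below. Conversely, a linear form \<open>\<Lambda>\<close> with coefficient vector \<open>e\<close> is realised by the torus whose
  weights span the orthogonal complement of \<open>e\<close>: the orbits of \<open>v\<close> and of \<open>(1, \<dots>, 1)\<close> then have distance at
  most \<open>\<bar>\<Lambda>\<bar>\<close>. For unimodular \<open>v\<close> the same arguments work with the compact torus, where Euclidean and
  logarithmic distance are comparable. For compact orbits with different moduli of the coordinates,
  the separation is elementary.
\<close>

section \<open>Polynomial bounds\<close>

text \<open>Every \<open>m k\<close> is at most \<open>X ^ sum D S\<close>, and the absolute
  coefficients add up to less than \<open>2 ^ N\<close>. Since \<open>2 \<le> X\<close>, this
  constant is absorbed into the exponent.\<close>

lemma coeff_sum_le_power: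
  fixes c :: "'k \<Rightarrow> real" and D :: "'k \<Rightarrow> nat"
  assumes "finite S"
  shows "\<exists>C. \<forall>X m. 2 \<le> X \<longrightarrow> (\<forall>k\<in>S. 0 \<le> m k \<and> m k \<le> X ^ D k) \<longrightarrow> (\<Sum>k\<in>S. c k * m k) \<le> X ^ C"
proof -
  obtain N :: nat where N: "(\<Sum>k\<in>S. \<bar>c k\<bar>) < 2 ^ N"
    using real_arch_pow[of 2 "\<Sum>k\<in>S. \<bar>c k\<bar>"] by auto
  have "(\<Sum>k\<in>S. c k * m k) \<le> X ^ (N + sum D S)"
    if X: "2 \<le> X" and m: "\<forall>k\<in>S. 0 \<le> m k \<and> m k \<le> X ^ D k" for X m
  proof -
    have "(\<Sum>k\<in>S. c k * m k) \<le> (\<Sum>k\<in>S. \<bar>c k\<bar> * X ^ sum D S)"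
    proof (rule sum_mono)
      fix k assume k: "k \<in> S"
      have "m k \<le> X ^ D k" using m k by blast
      also have "\<dots> \<le> X ^ sum D S"
        using X k assms by (intro power_increasing member_le_sum) auto
      finally show "c k * m k \<le> \<bar>c k\<bar> * X ^ sum D S"
        using m k by (intro mult_mono) auto
    qed
    also have "\<dots> = (\<Sum>k\<in>S. \<bar>c k\<bar>) * X ^ sum D S" by (simp add: sum_distrib_right)
    also have "\<dots> \<le> X ^ N * X ^ sum D S"
      using N X power_mono[of 2 X N] by (intro mult_right_mono) auto
    finally show ?thesis by (simp add: power_add)
  qed
  then show ?thesis by blast
qed

text \<open>Together with \<open>power_le_eval3\<close> this replaces the quantifier over
  polynomials by one over a single exponent. The summand 2 keeps the base at least 2, as
  \<open>coeff_sum_le_power\<close> demands.\<close>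

lemma eval3_le_power: "\<exists>C. \<forall>x y z. eval3 p x y z \<le> real (2 + x + y + z) ^ C"
proof -
  obtain C where C: "\<And>X m. 2 \<le> X \<Longrightarrow>
      (\<forall>k\<in>Poly_Mapping.keys p. 0 \<le> m k \<and> m k \<le> X ^ (case k of (i, j, l) \<Rightarrow> i + j + l)) \<Longrightarrow>
      (\<Sum>k\<in>Poly_Mapping.keys p. Poly_Mapping.lookup p k * m k) \<le> X ^ C"
    using coeff_sum_le_power[OF finite_keys[of p], of "\<lambda>k. case k of (i, j, l) \<Rightarrow> i + j + l"
        "Poly_Mapping.lookup p"] by auto
  have "eval3 p x y z \<le> real (2 + x + y + z) ^ C" for x y z
  proof -
    let ?X = "real (2 + x + y + z)"
    have "(\<Sum>k\<in>Poly_Mapping.keys p. Poly_Mapping.lookup p k *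
        (case k of (i, j, l) \<Rightarrow> real x ^ i * real y ^ j * real z ^ l)) \<le> ?X ^ C"
      by (rule C) (auto simp: power_add intro!: mult_mono power_mono)
    also have "(\<Sum>k\<in>Poly_Mapping.keys p. Poly_Mapping.lookup p k *
        (case k of (i, j, l) \<Rightarrow> real x ^ i * real y ^ j * real z ^ l)) = eval3 p x y z"
      unfolding eval3_def by (intro sum.cong) (auto simp: mult_ac)
    finally show ?thesis .
  qed
  then show ?thesis by blast
qed

lemma eval4_le_power: "\<exists>C. \<forall>x y z u. eval4 p x y z u \<le> real (2 + x + y + z + u) ^ C"
proof -
  obtain C where C: "\<And>X m. 2 \<le> X \<Longrightarrow>
      (\<forall>k\<in>Poly_Mapping.keys p. 0 \<le> m k \<and> m k \<le> X ^ (case k of (i, j, l, q) \<Rightarrow> i + j + l + q)) \<Longrightarrow>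
      (\<Sum>k\<in>Poly_Mapping.keys p. Poly_Mapping.lookup p k * m k) \<le> X ^ C"
    using coeff_sum_le_power[OF finite_keys[of p], of "\<lambda>k. case k of (i, j, l, q) \<Rightarrow> i + j + l + q"
        "Poly_Mapping.lookup p"] by auto
  have "eval4 p x y z u \<le> real (2 + x + y + z + u) ^ C" for x y z u
  proof -
    let ?X = "real (2 + x + y + z + u)"
    have "(\<Sum>k\<in>Poly_Mapping.keys p. Poly_Mapping.lookup p k *
        (case k of (i, j, l, q) \<Rightarrow> real x ^ i * real y ^ j * real z ^ l * real u ^ q)) \<le> ?X ^ C"
      by (rule C) (auto simp: power_add intro!: mult_mono power_mono)
    also have "(\<Sum>k\<in>Poly_Mapping.keys p. Poly_Mapping.lookup p k *
        (case k of (i, j, l, q) \<Rightarrow> real x ^ i * real y ^ j * real z ^ l * real u ^ q)) = eval4 p x y z u"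
      unfolding eval4_def by (intro sum.cong) (auto simp: mult_ac)
    finally show ?thesis .
  qed
  then show ?thesis by blast
qed

lemma ex_poly_mapping_with_coeffs:
  fixes c :: "'k \<Rightarrow> real"
  assumes "finite S" "\<And>k. k \<notin> S \<Longrightarrow> c k = 0"
  obtains p where "Poly_Mapping.lookup p = c" "Poly_Mapping.keys p \<subseteq> S"
proof
  have fin: "finite {k. c k \<noteq> 0}"
    using assms by (intro finite_subset[OF _ assms(1)]) auto
  show lk: "Poly_Mapping.lookup (Abs_poly_mapping c) = c" using fin by simp
  show "Poly_Mapping.keys (Abs_poly_mapping c) \<subseteq> S"
    using assms(2) fin by (force simp: in_keys_iff)
qed

lemma sum_binomial_power: "(\<Sum>i\<le>C. real (C choose i) * real x ^ i) = (1 + real x) ^ C"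
  using binomial_ring[of "real x" 1 C] by (simp add: add.commute)

text \<open>The sum in the base is at most a product with one factor per variable, and the binomial
  theorem for each factor yields explicit coefficients. The binomials vanish outside the box
  \<open>?S\<close>.\<close>

lemma power_le_eval3: "\<exists>p. \<forall>x y z. real (2 + x + y + z) ^ C \<le> eval3 p x y z"
proof -
  let ?S = "{..C} \<times> {..C} \<times> {..C}"
  obtain p where p: "Poly_Mapping.lookup p = (\<lambda>(i, j, l). 2 ^ C * real (C choose i) * real (C choose j) * real (C choose l))"
    and keys: "Poly_Mapping.keys p \<subseteq> ?S"
    by (rule ex_poly_mapping_with_coeffs[of ?S "\<lambda>(i, j, l). 2 ^ C * real (C choose i) * real (C choose j) * real (C choose l)"])
      (auto simp: binomial_eq_0 not_le)
  have "real (2 + x + y + z) ^ C \<le> eval3 p x y z" for x y z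
  proof -
    have "2 + x + y + z \<le> 2 * (1 + x) * (1 + y) * (1 + z)" by (simp add: algebra_simps)
    then have "real (2 + x + y + z) ^ C \<le> real (2 * (1 + x) * (1 + y) * (1 + z)) ^ C"
      by (intro power_mono) auto
    also have "\<dots> = 2 ^ C * ((1 + real x) ^ C * ((1 + real y) ^ C * (1 + real z) ^ C))"
      by (simp only: of_nat_mult of_nat_add of_nat_1 of_nat_numeral power_mult_distrib mult.assoc)
    also have "\<dots> = (\<Sum>i\<le>C. \<Sum>j\<le>C. \<Sum>l\<le>C. 2 ^ C * real (C choose i) * real (C choose j) * real (C choose l)
        * real x ^ i * real y ^ j * real z ^ l)"
      unfolding sum_binomial_power[symmetric] sum_distrib_right unfolding sum_distrib_left
      by (intro sum.cong refl) (simp add: mult_ac)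
    also have "\<dots> = (\<Sum>(i, j, l)\<in>?S. Poly_Mapping.lookup p (i, j, l) * real x ^ i * real y ^ j * real z ^ l)"
      by (simp add: sum.cartesian_product p)
    also have "\<dots> = eval3 p x y z"
      unfolding eval3_def using keys
      by (intro sum.mono_neutral_right) (auto simp: in_keys_iff)
    finally show ?thesis .
  qed
  then show ?thesis by blast
qed

lemma power_le_eval4: "\<exists>p. \<forall>x y z u. real (2 + x + y + z + u) ^ C \<le> eval4 p x y z u"
proof -
  let ?S = "{..C} \<times> {..C} \<times> {..C} \<times> {..C}"
  obtain p where p: "Poly_Mapping.lookup p =
      (\<lambda>(i, j, l, q). 2 ^ C * real (C choose i) * real (C choose j) * real (C choose l) * real (C choose q))"
    and keys: "Poly_Mapping.keys p \<subseteq> ?S"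
    by (rule ex_poly_mapping_with_coeffs[of ?S
          "\<lambda>(i, j, l, q). 2 ^ C * real (C choose i) * real (C choose j) * real (C choose l) * real (C choose q)"])
      (auto simp: binomial_eq_0 not_le)
  have "real (2 + x + y + z + u) ^ C \<le> eval4 p x y z u" for x y z u
  proof -
    have "2 + x + y + z + u \<le> 2 * (1 + x) * (1 + y) * (1 + z) * (1 + u)" by (simp add: algebra_simps)
    then have "real (2 + x + y + z + u) ^ C \<le> real (2 * (1 + x) * (1 + y) * (1 + z) * (1 + u)) ^ C"
      by (intro power_mono) auto
    also have "\<dots> = 2 ^ C * ((1 + real x) ^ C * ((1 + real y) ^ C * ((1 + real z) ^ C * (1 + real u) ^ C)))"
      by (simp only: of_nat_mult of_nat_add of_nat_1 of_nat_numeral power_mult_distrib mult.assoc)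
    also have "\<dots> = (\<Sum>i\<le>C. \<Sum>j\<le>C. \<Sum>l\<le>C. \<Sum>q\<le>C. 2 ^ C * real (C choose i) * real (C choose j) * real (C choose l)
        * real (C choose q) * real x ^ i * real y ^ j * real z ^ l * real u ^ q)"
      unfolding sum_binomial_power[symmetric] sum_distrib_right unfolding sum_distrib_left
      by (intro sum.cong refl) (simp add: mult_ac)
    also have "\<dots> = (\<Sum>(i, j, l, q)\<in>?S. Poly_Mapping.lookup p (i, j, l, q)
        * real x ^ i * real y ^ j * real z ^ l * real u ^ q)"
      by (simp add: sum.cartesian_product p)
    also have "\<dots> = eval4 p x y z u"
      unfolding eval4_def using keys
      by (intro sum.mono_neutral_right) (auto simp: in_keys_iff)
    finally show ?thesis .
  qed
  then show ?thesis by blast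
qed

text \<open>With \<open>sep_T\<close> and \<open>sep_K\<close> for \<open>f\<close>, this restates
  the separation hypotheses with a bound that is monotone in every parameter.\<close>

lemma ex_eval4_bound_iff:
  fixes f :: "nat \<Rightarrow> nat \<Rightarrow> nat \<Rightarrow> nat \<Rightarrow> ereal"
  shows "(\<exists>p. \<forall>d n B b. ereal (exp (- eval4 p d n b B)) \<le> f d n B b) \<longleftrightarrow>
    (\<exists>C. \<forall>d n B b. ereal (exp (- (real (2 + d + n + b + B) ^ C))) \<le> f d n B b)"
proof
  assume "\<exists>p. \<forall>d n B b. ereal (exp (- eval4 p d n b B)) \<le> f d n B b"
  then obtain p where p: "\<And>d n B b. ereal (exp (- eval4 p d n b B)) \<le> f d n B b" by blast
  obtain C where C: "\<And>x y z u. eval4 p x y z u \<le> real (2 + x + y + z + u) ^ C"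
    using eval4_le_power[of p] by blast
  show "\<exists>C. \<forall>d n B b. ereal (exp (- (real (2 + d + n + b + B) ^ C))) \<le> f d n B b"
    using order_trans[OF _ p] C by (intro exI[of _ C]) (force simp del: of_nat_add)
next
  assume "\<exists>C. \<forall>d n B b. ereal (exp (- (real (2 + d + n + b + B) ^ C))) \<le> f d n B b"
  then obtain C where C: "\<And>d n B b. ereal (exp (- (real (2 + d + n + b + B) ^ C))) \<le> f d n B b"
    by blast
  obtain p where p: "\<And>x y z u. real (2 + x + y + z + u) ^ C \<le> eval4 p x y z u"
    using power_le_eval4[of C] by blast
  show "\<exists>p. \<forall>d n B b. ereal (exp (- eval4 p d n b B)) \<le> f d n B b"
    using order_trans[OF _ C] p by (intro exI[of _ p]) (force simp del: of_nat_add)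
qed

text \<open>
  Passing to a monotone bound replaces the maximal bit-lengths, which are junk for \<open>n = 0\<close>, by upper
  bounds.
\<close>

lemma number_theoretic_hypothesis_on_iff:
  "number_theoretic_hypothesis_on A \<longleftrightarrow>
    (\<exists>C. \<forall>n v e b B. (\<forall>j<n. v j \<in> gauss_rats - {0} \<and> v j \<in> A \<and> gauss_bits (v j) \<le> b \<and> int_bits (e j) \<le> B) \<longrightarrow>
       log_form n v e \<noteq> 0 \<longrightarrow> exp (- (real (2 + n + b + B) ^ C)) \<le> cmod (log_form n v e))"
  (is "?L \<longleftrightarrow> (\<exists>C. ?R C)")
proof
  assume ?L
  then obtain p where p: "\<And>n v e. (\<forall>j<n. v j \<in> gauss_rats - {0} \<and> v j \<in> A) \<Longrightarrow> log_form n v e \<noteq> 0 \<Longrightarrow>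
       exp (- eval3 p n (Max ((\<lambda>j. gauss_bits (v j)) ` {..<n})) (Max ((\<lambda>j. int_bits (e j)) ` {..<n})))
       \<le> cmod (log_form n v e)"
    unfolding number_theoretic_hypothesis_on_def by blast
  obtain C where C: "\<And>x y z. eval3 p x y z \<le> real (2 + x + y + z) ^ C"
    using eval3_le_power[of p] by blast
  have "?R C"
  proof (intro allI impI)
    fix n v e b B
    assume v: "\<forall>j<n. v j \<in> gauss_rats - {0} \<and> v j \<in> A \<and> gauss_bits (v j) \<le> b \<and> int_bits (e j) \<le> B"
      and nz: "log_form n v e \<noteq> 0"
    let ?b = "Max ((\<lambda>j. gauss_bits (v j)) ` {..<n})" and ?B = "Max ((\<lambda>j. int_bits (e j)) ` {..<n})"
    have "n \<noteq> 0" using nz by (intro notI) (simp add: log_form_def)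
    then have le: "?b \<le> b" "?B \<le> B" using v by (auto simp: lessThan_empty_iff)
    have "eval3 p n ?b ?B \<le> real (2 + n + ?b + ?B) ^ C" by (rule C)
    also have "\<dots> \<le> real (2 + n + b + B) ^ C" using le by (intro power_mono) auto
    finally have "exp (- (real (2 + n + b + B) ^ C)) \<le> exp (- eval3 p n ?b ?B)" by simp
    also have "\<dots> \<le> cmod (log_form n v e)" using v nz by (intro p) auto
    finally show "exp (- (real (2 + n + b + B) ^ C)) \<le> cmod (log_form n v e)" .
  qed
  then show "\<exists>C. ?R C" by blast
next
  assume "\<exists>C. ?R C"
  then obtain C where C: "?R C" by blast
  obtain p where p: "\<And>x y z. real (2 + x + y + z) ^ C \<le> eval3 p x y z"
    using power_le_eval3[of C] by blast
  show ?L unfolding number_theoretic_hypothesis_on_def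
  proof (intro exI[of _ p] allI impI)
    fix n v e
    assume v: "\<forall>j<n. v j \<in> gauss_rats - {0} \<and> v j \<in> A" and nz: "log_form n v e \<noteq> 0"
    let ?b = "Max ((\<lambda>j. gauss_bits (v j)) ` {..<n})" and ?B = "Max ((\<lambda>j. int_bits (e j)) ` {..<n})"
    have "exp (- eval3 p n ?b ?B) \<le> exp (- (real (2 + n + ?b + ?B) ^ C))" using p by simp
    also have "\<dots> \<le> cmod (log_form n v e)" using v nz C by auto
    finally show "exp (- eval3 p n ?b ?B) \<le> cmod (log_form n v e)" .
  qed
qed

section \<open>Small kernel vectors of integer matrices\<close>

text \<open>The Leibniz formula has \<open>fact r\<close> terms, each a signed product of
  \<open>r\<close> entries.\<close>

lemma abs_det_int_le:
  fixes A :: "int mat"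
  assumes A: "A \<in> carrier_mat r r" and bd: "\<And>i j. i < r \<Longrightarrow> j < r \<Longrightarrow> \<bar>A $$ (i, j)\<bar> \<le> H"
  shows "\<bar>Determinant.det A\<bar> \<le> fact r * H ^ r"
proof -
  let ?P = "{p. p permutes {0..<r}}"
  have "\<bar>Determinant.det A\<bar> \<le> (\<Sum>p\<in>?P. \<bar>of_int (sign p) * (\<Prod>i = 0..<r. A $$ (i, p i))\<bar>)"
    unfolding det_def'[OF A] by (rule sum_abs)
  also have "\<dots> \<le> (\<Sum>p\<in>?P. H ^ r)"
  proof (rule sum_mono)
    fix p assume "p \<in> ?P"
    then have p: "p i < r" if "i < r" for i
      using that permutes_in_image[of p "{0..<r}" i] by auto
    have "\<bar>of_int (sign p) * (\<Prod>i = 0..<r. A $$ (i, p i))\<bar> = (\<Prod>i = 0..<r. \<bar>A $$ (i, p i)\<bar>)"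
      by (simp add: abs_mult abs_prod sign_def)
    also have "\<dots> \<le> (\<Prod>i = 0..<r. H)"
      by (rule prod_mono) (use bd p in auto)
    finally show "\<bar>of_int (sign p) * (\<Prod>i = 0..<r. A $$ (i, p i))\<bar> \<le> H ^ r" by simp
  qed
  also have "\<dots> = fact r * H ^ r"
    using card_permutations[of "{0..<r}" r] by simp
  finally show ?thesis .
qed

text \<open>
  The witness is read off a maximal nonvanishing minor: expanding the bordered minors along their
  last row gives kernel vectors of the matrix, and expanding the same determinants, with \<open>x\<close> as the
  last row, along the last column writes \<open>x\<close> as a combination of the rows if they all vanish.
\<close>

lemma small_kernel_vector:
  fixes M :: "nat \<Rightarrow> nat \<Rightarrow> int" and x :: "nat \<Rightarrow> 'a :: field_char_0"
  assumes H: "H \<ge> 1" and bd: "\<And>i j. i < d \<Longrightarrow> j < n \<Longrightarrow> \<bar>M i j\<bar> \<le> H"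
    and notspan: "\<not> (\<exists>s. \<forall>j<n. x j = (\<Sum>i<d. of_int (M i j) * s i))"
  obtains h :: "nat \<Rightarrow> int" where
    "\<And>i. i < d \<Longrightarrow> (\<Sum>j<n. M i j * h j) = 0"
    "\<And>j. j < n \<Longrightarrow> \<bar>h j\<bar> \<le> fact (Suc n) * H ^ n"
    "(\<Sum>j<n. of_int (h j) * x j) \<noteq> 0"
proof -
  \<comment> \<open>Rows and columns are selected by index maps that may repeat. A repeated column
    makes the minor vanish, which bounds the order of a nonvanishing minor by
    \<open>n\<close>.\<close>
  define minor where "minor r I J = Determinant.det (mat r r (\<lambda>(a, b). M (I a) (J b)))" for r and I J :: "nat \<Rightarrow> nat"
  define P where "P r \<longleftrightarrow> (\<exists>I J. I ` {..<r} \<subseteq> {..<d} \<and> J ` {..<r} \<subseteq> {..<n} \<and> minor r I J \<noteq> 0)" for r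
  have "P 0" by (auto simp: P_def minor_def)
  have P_le: "r \<le> n" if "P r" for r
  proof -
    from that obtain I J where J: "J ` {..<r} \<subseteq> {..<n}" and m: "minor r I J \<noteq> 0"
      by (auto simp: P_def)
    have "inj_on J {..<r}"
    proof (rule inj_onI, rule ccontr)
      fix a b assume "a \<in> {..<r}" "b \<in> {..<r}" "J a = J b" "a \<noteq> b"
      then have "minor r I J = 0" unfolding minor_def
        by (intro det_identical_columns[of _ r a b]) auto
      with m show False by simp
    qed
    from card_inj_on_le[OF this J] show ?thesis by simp
  qed
  \<comment> \<open>\<open>r\<close> is the rank of \<open>M\<close>.\<close>
  define r where "r = (GREATEST r. P r)"
  have "P r" unfolding r_def by (rule GreatestI_nat[of P 0 n]) (use \<open>P 0\<close> P_le in auto)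
  have r_max: "\<not> P (Suc r)"
    using Greatest_le_nat[of P "Suc r" n] P_le by (auto simp: r_def)
  have "r \<le> n" using \<open>P r\<close> P_le by blast
  from \<open>P r\<close> obtain I J where I: "I ` {..<r} \<subseteq> {..<d}" and J: "J ` {..<r} \<subseteq> {..<n}"
    and D0: "minor r I J \<noteq> 0" by (auto simp: P_def)
  define D where "D = minor r I J"
  define Jj where "Jj j b = (if b < r then J b else j)" for j b
  have Jj: "Jj j b < n" if "j < n" "b < Suc r" for j b
    using that J by (auto simp: Jj_def less_Suc_eq)
  define Wi where "Wi y j = mat (Suc r) (Suc r) (\<lambda>(a, b). if a < r then M (I a) (Jj j b) else y (Jj j b))"
    for y :: "nat \<Rightarrow> int" and j
  define W where "W j = mat (Suc r) (Suc r) (\<lambda>(a, b). if a < r then of_int (M (I a) (Jj j b)) else x (Jj j b))"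
    for j
  have Wi_c: "Wi y j \<in> carrier_mat (Suc r) (Suc r)" for y j by (simp add: Wi_def)
  have W_c: "W j \<in> carrier_mat (Suc r) (Suc r)" for j by (simp add: W_def)
  \<comment> \<open>Cofactors along the last row do not depend on that row, so they are computed
    with a zero row; the same integers serve for \<open>Wi y j\<close> and, after coercion, for
    \<open>W j\<close>.\<close>
  define C where "C j b = cofactor (Wi (\<lambda>_. 0) j) r b" for j b
  have cof_Wi: "cofactor (Wi y j) r b = C j b" if "b < Suc r" for y j b
  proof -
    have "mat_delete (Wi y j) r b = mat_delete (Wi (\<lambda>_. 0) j) r b"
      unfolding mat_delete_def Wi_def using that by (intro eq_matI) auto
    then show ?thesis by (simp add: C_def cofactor_def)
  qed
  have cof_W: "cofactor (W j) r b = of_int (C j b)" if "b < Suc r" for j b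
  proof -
    have "mat_delete (W j) r b = map_mat of_int (mat_delete (Wi (\<lambda>_. 0) j) r b)"
      unfolding mat_delete_def Wi_def W_def using that by (intro eq_matI) auto
    then show ?thesis by (simp add: C_def cofactor_def)
  qed
  have C_last: "C j r = D" for j
  proof -
    have "mat_delete (Wi (\<lambda>_. 0) j) r r = mat r r (\<lambda>(a, b). M (I a) (J b))"
      unfolding mat_delete_def Wi_def by (intro eq_matI) (auto simp: Jj_def)
    then show ?thesis by (simp add: C_def D_def minor_def cofactor_def)
  qed
  \<comment> \<open>The cofactor of position \<open>b\<close> is placed at coordinate
    \<open>Jj j b\<close>. The sum is there because \<open>j\<close> may already be among the
    selected columns; pairing \<open>h j\<close> with \<open>y\<close> is then the Laplace expansion
    with last row \<open>y\<close>.\<close>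
  define h where "h j l = (\<Sum>b<Suc r. if Jj j b = l then C j b else 0)" for j l
  have h_sum: "(\<Sum>l<n. of_int (h j l) * y l) = (\<Sum>b<Suc r. y (Jj j b) * of_int (C j b))"
    if "j < n" for j and y :: "nat \<Rightarrow> 'b :: comm_ring_1"
  proof -
    have "(\<Sum>l<n. of_int (h j l) * y l) = (\<Sum>l<n. \<Sum>b<Suc r. (if Jj j b = l then y l * of_int (C j b) else 0))"
      unfolding h_def of_int_sum sum_distrib_right by (intro sum.cong) auto
    also have "\<dots> = (\<Sum>b<Suc r. \<Sum>l<n. (if l = Jj j b then y l * of_int (C j b) else 0))"
      by (subst sum.swap) (intro sum.cong, auto)
    also have "\<dots> = (\<Sum>b<Suc r. y (Jj j b) * of_int (C j b))"
      by (intro sum.cong refl) (use Jj that in auto)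
    finally show ?thesis .
  qed
  \<comment> \<open>With row \<open>i\<close> of \<open>M\<close> as the last row, the bordered
    determinant is a minor of order \<open>Suc r\<close>, which vanishes by maximality of
    \<open>r\<close>.\<close>
  have ker: "(\<Sum>l<n. M i l * h j l) = 0" if "i < d" "j < n" for i j
  proof -
    have "(\<Sum>l<n. M i l * h j l) = (\<Sum>b<Suc r. M i (Jj j b) * C j b)"
      using h_sum[OF \<open>j < n\<close>, of "M i"] by (simp add: mult.commute)
    also have "\<dots> = (\<Sum>b<Suc r. Wi (M i) j $$ (r, b) * cofactor (Wi (M i) j) r b)"
      by (intro sum.cong refl) (simp add: cof_Wi, simp add: Wi_def)
    also have "\<dots> = Determinant.det (Wi (M i) j)"
      by (rule laplace_expansion_row[OF Wi_c, symmetric]) simp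
    also have "Wi (M i) j = mat (Suc r) (Suc r) (\<lambda>(a, b). M ((\<lambda>a. if a < r then I a else i) a) (Jj j b))"
      unfolding Wi_def by (intro eq_matI) auto
    also have "Determinant.det \<dots> = minor (Suc r) (\<lambda>a. if a < r then I a else i) (Jj j)"
      by (simp add: minor_def)
    also have "\<dots> = 0"
    proof (rule ccontr)
      assume "minor (Suc r) (\<lambda>a. if a < r then I a else i) (Jj j) \<noteq> 0"
      moreover have "(\<lambda>a. if a < r then I a else i) ` {..<Suc r} \<subseteq> {..<d}"
        using I that by auto
      moreover have "Jj j ` {..<Suc r} \<subseteq> {..<n}" using Jj that by auto
      ultimately show False using r_max unfolding P_def by blast
    qed
    finally show ?thesis .
  qed
  have C_bd: "\<bar>C j b\<bar> \<le> fact r * H ^ r" if "j < n" "b < Suc r" for j b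
  proof -
    have "\<bar>C j b\<bar> = \<bar>Determinant.det (mat_delete (Wi (\<lambda>_. 0) j) r b)\<bar>"
      by (simp add: C_def cofactor_def abs_mult)
    also have "\<dots> \<le> fact r * H ^ r"
    proof (rule abs_det_int_le)
      show "mat_delete (Wi (\<lambda>_. 0) j) r b \<in> carrier_mat r r"
        using mat_delete_carrier[OF Wi_c] by simp
      fix a c assume ac: "a < r" "c < r"
      have "I a < d" using I ac by auto
      moreover have "Jj j (if c < b then c else Suc c) < n" using Jj that ac by auto
      ultimately show "\<bar>mat_delete (Wi (\<lambda>_. 0) j) r b $$ (a, c)\<bar> \<le> H"
        using ac bd by (auto simp: mat_delete_def Wi_def split: if_splits)
    qed
    finally show ?thesis .
  qed
  have h_bd: "\<bar>h j l\<bar> \<le> fact (Suc n) * H ^ n" if "j < n" for j l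
  proof -
    have "\<bar>h j l\<bar> \<le> (\<Sum>b<Suc r. \<bar>if Jj j b = l then C j b else 0\<bar>)"
      unfolding h_def by (rule sum_abs)
    also have "\<dots> \<le> (\<Sum>b<Suc r. fact r * H ^ r)"
      using C_bd[OF that] H by (intro sum_mono) (auto simp: less_Suc_eq)
    also have "\<dots> = fact (Suc r) * H ^ r" by (simp add: algebra_simps)
    also have "\<dots> \<le> fact (Suc n) * H ^ n"
      using \<open>r \<le> n\<close> H by (intro mult_mono fact_mono power_increasing) auto
    finally show ?thesis .
  qed
  have det_W: "(\<Sum>l<n. of_int (h j l) * x l) = Determinant.det (W j)" if "j < n" for j
  proof -
    have "(\<Sum>l<n. of_int (h j l) * x l) = (\<Sum>b<Suc r. W j $$ (r, b) * cofactor (W j) r b)"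
      unfolding h_sum[OF that] by (intro sum.cong refl) (simp add: cof_W, simp add: W_def)
    also have "\<dots> = Determinant.det (W j)"
      by (rule laplace_expansion_row[OF W_c, symmetric]) simp
    finally show ?thesis .
  qed
  have "\<exists>j<n. (\<Sum>l<n. of_int (h j l) * x l) \<noteq> 0"
  proof (rule ccontr)
    assume "\<not> ?thesis"
    then have det0: "Determinant.det (W j) = 0" if "j < n" for j using that det_W by auto
    \<comment> \<open>Cofactors along the last column do not see that column, the only one in which
      \<open>W j\<close> depends on \<open>j\<close>. Hence one vector \<open>s\<close> serves all
      coordinates.\<close>
    define E where "E a = cofactor (W 0) a r" for a
    have E: "cofactor (W j) a r = E a" if "a < r" for a j
    proof -
      have "mat_delete (W j) a r = mat_delete (W 0) a r"
        unfolding mat_delete_def W_def using that by (intro eq_matI) (auto simp: Jj_def)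
      then show ?thesis by (simp add: E_def cofactor_def)
    qed
    define s where "s i = (\<Sum>a<r. if I a = i then - E a / of_int D else 0)" for i
    have "x j = (\<Sum>i<d. of_int (M i j) * s i)" if "j < n" for j
    proof -
      have "0 = (\<Sum>a<Suc r. W j $$ (a, r) * cofactor (W j) a r)"
        using laplace_expansion_column[OF W_c[of j], of r] det0[OF that] by simp
      also have "\<dots> = (\<Sum>a<r. of_int (M (I a) j) * E a) + x j * of_int D"
        by (simp add: cof_W C_last E) (simp add: W_def Jj_def)
      finally have "x j = - (\<Sum>a<r. of_int (M (I a) j) * E a) / of_int D"
        using D0 by (simp add: D_def field_simps eq_neg_iff_add_eq_0)
      also have "\<dots> = (\<Sum>a<r. of_int (M (I a) j) * (- E a / of_int D))"
        by (simp add: sum_divide_distrib sum_negf)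
      also have "\<dots> = (\<Sum>a<r. \<Sum>i<d. if i = I a then of_int (M i j) * (- E a / of_int D) else 0)"
        by (intro sum.cong refl) (use I in auto)
      also have "\<dots> = (\<Sum>i<d. of_int (M i j) * s i)"
        unfolding s_def sum_distrib_left by (subst sum.swap) (intro sum.cong, auto)
      finally show ?thesis .
    qed
    with notspan show False by blast
  qed
  then obtain j where "j < n" "(\<Sum>l<n. of_int (h j l) * x l) \<noteq> 0" by blast
  with that[of "h j"] ker h_bd show ?thesis by blast
qed

section \<open>Bit-lengths of Gaussian rationals\<close>

text \<open>The sign bit accounts for the \<open>Suc\<close>.\<close>

lemma int_bits_le_iff: "int_bits k \<le> Suc L \<longleftrightarrow> \<bar>k\<bar> < 2 ^ L"
  using bitlen_le_iff_power[of "\<bar>k\<bar>" "int L"] bitlen_nonneg[of "\<bar>k\<bar>"]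
  by (simp add: int_bits_def nat_le_iff)

lemma int_bits_pos: "0 < int_bits k"
  by (simp add: int_bits_def)

lemma abs_le_of_int_bits:
  assumes "int_bits k \<le> B"
  shows "\<bar>k\<bar> \<le> 2 ^ B"
proof -
  obtain L where L: "B = Suc L" using assms int_bits_pos[of k] by (cases B) auto
  have "\<bar>k\<bar> < 2 ^ L" using assms by (simp add: L int_bits_le_iff)
  also have "\<dots> \<le> 2 ^ B" by (simp add: L)
  finally show ?thesis by simp
qed

lemma int_bits_abs_eq: "\<bar>k\<bar> = \<bar>l\<bar> \<Longrightarrow> int_bits k = int_bits l"
  by (simp add: int_bits_def)

text \<open>The common denominator need not be the least one, so arithmetic proceeds without
  cancellation. Going from bit-lengths to this notion and back changes them by a linear function
  only.\<close>

definition gauss_frac :: "nat \<Rightarrow> complex \<Rightarrow> bool" where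
  "gauss_frac k z \<longleftrightarrow> (\<exists>p q c :: int. 0 < c \<and> c \<le> 2 ^ k \<and> \<bar>p\<bar> \<le> 2 ^ k \<and> \<bar>q\<bar> \<le> 2 ^ k \<and>
     z = Complex (of_int p / of_int c) (of_int q / of_int c))"

lemma rat_bits_bounds:
  assumes "quotient_of q = (a, c)"
  obtains k l where "\<bar>a\<bar> \<le> 2 ^ k" "c \<le> 2 ^ l" "0 < c" "k + l < rat_bits q"
proof
  have c: "0 < c" using assms quotient_of_denom_pos by blast
  then show "0 < c" .
  show "\<bar>a\<bar> \<le> 2 ^ nat (bitlen \<bar>a\<bar>)"
    using bitlen_bounds[of "\<bar>a\<bar>"] by (cases "a = 0") auto
  show "c \<le> 2 ^ nat (bitlen c)" using bitlen_bounds[OF c] by auto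
  show "nat (bitlen \<bar>a\<bar>) + nat (bitlen c) < rat_bits q" by (simp add: rat_bits_def assms)
qed

lemma of_rat_quotient: "quotient_of q = (a, c) \<Longrightarrow> (of_rat q :: real) = of_int a / of_int c"
  by (metis quotient_of_div of_rat_divide of_rat_of_int_eq)

lemma the_inv_of_rat: "the_inv (of_rat :: rat \<Rightarrow> real) (of_rat q) = q"
  by (rule the_inv_f_f) (auto simp: inj_def)

lemma gauss_frac_of_gauss_bits:
  assumes z: "z \<in> gauss_rats" and b: "gauss_bits z \<le> b"
  shows "gauss_frac b z"
proof -
  from z obtain q r where q: "Re z = of_rat q" and r: "Im z = of_rat r"
    by (auto simp: gauss_rats_def Rats_def)
  obtain a c where ac: "quotient_of q = (a, c)" by (cases "quotient_of q")
  obtain a' c' where ac': "quotient_of r = (a', c')" by (cases "quotient_of r")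
  obtain k l where kl: "\<bar>a\<bar> \<le> 2 ^ k" "c \<le> 2 ^ l" "0 < c" "k + l < rat_bits q"
    using rat_bits_bounds[OF ac] .
  obtain k' l' where kl': "\<bar>a'\<bar> \<le> 2 ^ k'" "c' \<le> 2 ^ l'" "0 < c'" "k' + l' < rat_bits r"
    using rat_bits_bounds[OF ac'] .
  have bits: "rat_bits q + rat_bits r \<le> b" using b by (simp add: gauss_bits_def q r the_inv_of_rat)
  \<comment> \<open>Over the common denominator \<open>c * c'\<close>, each integer is a product of
    two factors whose bit-lengths are counted separately in \<open>gauss_bits z\<close>; their
    exponents therefore add up to at most \<open>b\<close>.\<close>
  have prod_le: "x * y \<le> 2 ^ b" if "0 \<le> x" "0 \<le> y" "x \<le> 2 ^ m" "y \<le> 2 ^ m'" "m + m' \<le> b"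
    for x y :: int and m m'
  proof -
    have "x * y \<le> 2 ^ m * 2 ^ m'" using that by (intro mult_mono) auto
    also have "\<dots> = 2 ^ (m + m')" by (simp add: power_add)
    also have "\<dots> \<le> 2 ^ b" using that by (intro power_increasing) auto
    finally show ?thesis .
  qed
  have "0 < c * c'" using kl kl' by simp
  moreover have "c * c' \<le> 2 ^ b" using kl kl' bits by (intro prod_le[of _ _ l l']) auto
  moreover have "\<bar>a * c'\<bar> \<le> 2 ^ b"
    unfolding abs_mult using kl kl' bits by (intro prod_le[of _ _ k l']) auto
  moreover have "\<bar>a' * c\<bar> \<le> 2 ^ b"
    unfolding abs_mult using kl kl' bits by (intro prod_le[of _ _ k' l]) auto
  moreover have "z = Complex (of_int (a * c') / of_int (c * c')) (of_int (a' * c) / of_int (c * c'))"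
    using kl kl' by (simp add: complex_eq_iff q r of_rat_quotient[OF ac] of_rat_quotient[OF ac'])
  ultimately show ?thesis unfolding gauss_frac_def by blast
qed

text \<open>Cancelling the gcd does not enlarge numerator or denominator. Each has at most
  \<open>k + 1\<close> digits, because the value \<open>2 ^ k\<close> itself is allowed, and the
  sign contributes one more bit.\<close>

lemma rat_bits_le_of_frac:
  assumes "0 < c" "c \<le> 2 ^ k" "\<bar>p\<bar> \<le> 2 ^ k"
  shows "rat_bits (of_int p / of_int c) \<le> 2 * k + 3"
proof -
  obtain a c' where q: "quotient_of (of_int p / of_int c) = (a, c')" by (cases "quotient_of (of_int p / of_int c)")
  have "quotient_of (of_int p / of_int c) = Rat.normalize (p, c)"
    by (simp add: Fract_of_int_quotient[symmetric] quotient_of_Fract)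
  define g where "g = gcd p c"
  have ac: "a = p div g" "c' = c div g"
    using \<open>quotient_of _ = Rat.normalize _\<close> q assms(1) by (auto simp: Rat.normalize_def Let_def g_def)
  have g: "0 < g" using assms(1) by (simp add: g_def)
  have dv: "g dvd p" "g dvd c" by (auto simp: g_def)
  have "\<bar>a\<bar> \<le> \<bar>p\<bar>"
  proof -
    obtain m where m: "p = g * m" using dv by blast
    then have "a = m" using g ac by simp
    then show ?thesis using m g by (simp add: abs_mult mult_le_cancel_right1)
  qed
  then have "\<bar>a\<bar> \<le> 2 ^ k" using assms by simp
  then have "\<bar>a\<bar> < 2 ^ (k + 1)" by (smt (verit) power_strict_increasing_iff zero_less_power less_add_one)
  then have 1: "bitlen \<bar>a\<bar> \<le> int (k + 1)" unfolding bitlen_le_iff_power nat_int by simp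
  have "c' \<le> c"
  proof -
    obtain m where m: "c = g * m" using dv by blast
    then have "c' = m" using g ac by simp
    then show ?thesis using m g assms(1) by (simp add: mult_le_cancel_right1 zero_less_mult_iff)
  qed
  then have "c' \<le> 2 ^ k" using assms by simp
  then have "c' < 2 ^ (k + 1)" by (smt (verit) power_strict_increasing_iff zero_less_power less_add_one)
  then have 2: "bitlen c' \<le> int (k + 1)" unfolding bitlen_le_iff_power nat_int by simp
  show ?thesis using 1 2 by (simp add: rat_bits_def q)
qed

lemma gauss_frac_imp_bits:
  assumes "gauss_frac k z"
  shows "z \<in> gauss_rats" "gauss_bits z \<le> 4 * k + 6"
proof -
  from assms obtain p q c :: int where c: "0 < c" "c \<le> 2 ^ k" and p: "\<bar>p\<bar> \<le> 2 ^ k" and q: "\<bar>q\<bar> \<le> 2 ^ k"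
    and z: "z = Complex (of_int p / of_int c) (of_int q / of_int c)"
    unfolding gauss_frac_def by blast
  have "Re z = of_rat (of_int p / of_int c)" "Im z = of_rat (of_int q / of_int c)"
    by (simp_all add: z of_rat_divide)
  then show "z \<in> gauss_rats" "gauss_bits z \<le> 4 * k + 6"
    using rat_bits_le_of_frac[OF c p] rat_bits_le_of_frac[OF c q]
    by (auto simp: gauss_rats_def gauss_bits_def the_inv_of_rat)
qed

text \<open>Multiplying by the conjugate of \<open>w\<close> makes the denominator an integer. Each
  resulting integer is a signed sum of two products of three integers bounded by
  \<open>2 ^ k\<close>, hence \<open>3 * k + 1\<close>.\<close>

lemma gauss_frac_divide:
  assumes "gauss_frac k v" "gauss_frac k w" "w \<noteq> 0"
  shows "gauss_frac (3 * k + 1) (v / w)"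
proof -
  from assms(1) obtain p q c :: int where c: "0 < c" "c \<le> 2 ^ k" and p: "\<bar>p\<bar> \<le> 2 ^ k" and q: "\<bar>q\<bar> \<le> 2 ^ k"
    and v: "v = Complex (of_int p / of_int c) (of_int q / of_int c)"
    unfolding gauss_frac_def by blast
  from assms(2) obtain p' q' c' :: int where c': "0 < c'" "c' \<le> 2 ^ k" and p': "\<bar>p'\<bar> \<le> 2 ^ k" and q': "\<bar>q'\<bar> \<le> 2 ^ k"
    and w: "w = Complex (of_int p' / of_int c') (of_int q' / of_int c')"
    unfolding gauss_frac_def by blast
  have nz: "p' \<noteq> 0 \<or> q' \<noteq> 0" using assms(3) w by (auto simp: complex_eq_iff)
  have N: "0 < p'\<^sup>2 + q'\<^sup>2" using nz by (auto simp: sum_power2_gt_zero_iff)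
  have K: "(2::int) ^ (3 * k + 1) = 2 * (2 ^ k * 2 ^ k * 2 ^ k)"
    by (simp add: power_add[symmetric] mult_2[symmetric])
  have three: "\<bar>x * y * t\<bar> \<le> 2 ^ k * 2 ^ k * 2 ^ k" if "\<bar>x\<bar> \<le> 2 ^ k" "\<bar>y\<bar> \<le> 2 ^ k" "\<bar>t\<bar> \<le> 2 ^ k" for x y t :: int
    unfolding abs_mult using that by (intro mult_mono) auto
  have "0 < c * (p'\<^sup>2 + q'\<^sup>2)" using c N by simp
  moreover have "c * (p'\<^sup>2 + q'\<^sup>2) \<le> 2 ^ (3 * k + 1)"
    using three[of p' p' c] three[of q' q' c] p' q' c unfolding K
    by (simp add: power2_eq_square algebra_simps)
  moreover have "\<bar>(p * p' + q * q') * c'\<bar> \<le> 2 ^ (3 * k + 1)"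
    using three[of p p' c'] three[of q q' c'] p q p' q' c' unfolding K
    by (simp add: algebra_simps)
  moreover have "\<bar>(q * p' - p * q') * c'\<bar> \<le> 2 ^ (3 * k + 1)"
    using three[of q p' c'] three[of p q' c'] p q p' q' c' unfolding K
    by (simp add: algebra_simps)
  moreover have "v / w = Complex (of_int ((p * p' + q * q') * c') / of_int (c * (p'\<^sup>2 + q'\<^sup>2)))
      (of_int ((q * p' - p * q') * c') / of_int (c * (p'\<^sup>2 + q'\<^sup>2)))"
  proof -
    have Nr: "(real_of_int p')\<^sup>2 + (real_of_int q')\<^sup>2 \<noteq> 0" using nz by (simp add: sum_power2_eq_zero_iff)
    have "Complex (of_int ((p * p' + q * q') * c') / of_int (c * (p'\<^sup>2 + q'\<^sup>2)))
      (of_int ((q * p' - p * q') * c') / of_int (c * (p'\<^sup>2 + q'\<^sup>2))) * w = v"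
      using c c' Nr nz unfolding v w complex_eq_iff
      by (simp add: divide_simps) (auto simp: algebra_simps power2_eq_square)
    then show ?thesis using assms(3) by (simp add: field_simps)
  qed
  ultimately show ?thesis unfolding gauss_frac_def by blast
qed

text \<open>The bound is \<open>4 * (3 * b + 1) + 6\<close>, from \<open>gauss_frac_divide\<close>
  and \<open>gauss_frac_imp_bits\<close>.\<close>

lemma gauss_bits_divide:
  assumes "v \<in> gauss_rats" "gauss_bits v \<le> b" "w \<in> gauss_rats" "gauss_bits w \<le> b" "w \<noteq> 0"
  shows "v / w \<in> gauss_rats" "gauss_bits (v / w) \<le> 12 * b + 10"
  using gauss_frac_imp_bits[OF gauss_frac_divide[OF gauss_frac_of_gauss_bits[OF assms(1,2)]
        gauss_frac_of_gauss_bits[OF assms(3,4)] assms(5)]] by auto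

section \<open>Moduli and logarithms of Gaussian fractions\<close>

lemma gauss_frac_cmod_sq:
  assumes "gauss_frac k z"
  obtains a c :: int where "0 < c" "c \<le> 2 ^ (2 * k)" "0 \<le> a" "a \<le> 2 ^ (2 * k + 1)" "(cmod z)\<^sup>2 = of_int a / of_int c"
proof -
  from assms obtain p q c :: int where c: "0 < c" "c \<le> 2 ^ k" and p: "\<bar>p\<bar> \<le> 2 ^ k" and q: "\<bar>q\<bar> \<le> 2 ^ k"
    and z: "z = Complex (of_int p / of_int c) (of_int q / of_int c)"
    unfolding gauss_frac_def by blast
  have sq: "x\<^sup>2 \<le> 2 ^ (2 * k)" if "\<bar>x\<bar> \<le> 2 ^ k" for x :: int
    using power_mono[OF that, of 2] by (simp add: power_mult[symmetric] mult.commute)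
  show thesis
  proof (rule that[of "c\<^sup>2" "p\<^sup>2 + q\<^sup>2"])
    show "(cmod z)\<^sup>2 = of_int (p\<^sup>2 + q\<^sup>2) / of_int (c\<^sup>2)"
      by (simp add: z cmod_power2 power_divide add_divide_distrib)
  qed (use sq[OF p] sq[OF q] sq[of c] c in auto)
qed

lemma gauss_frac_cmod_bounds:
  assumes "gauss_frac k z" "z \<noteq> 0"
  shows "1 / 2 ^ k \<le> cmod z" "cmod z \<le> 2 ^ (k + 1)"
proof -
  obtain a c :: int where c: "0 < c" "c \<le> 2 ^ (2 * k)" and a: "0 \<le> a" "a \<le> 2 ^ (2 * k + 1)"
    and e: "(cmod z)\<^sup>2 = of_int a / of_int c"
    using gauss_frac_cmod_sq[OF assms(1)] .
  have "a \<noteq> 0" using e assms(2) by auto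
  then have a1: "1 \<le> a" using a by simp
  have cr: "real_of_int c \<le> 2 ^ (2 * k)" using c(2) by (metis of_int_le_iff of_int_numeral of_int_power)
  have ar: "real_of_int a \<le> 2 ^ (2 * k + 1)" using a(2) by (metis of_int_le_iff of_int_numeral of_int_power)
  have "(1 / 2 ^ k)\<^sup>2 = 1 / (2::real) ^ (2 * k)" by (simp add: power_divide power_mult[symmetric] mult.commute)
  also have "\<dots> \<le> of_int a / of_int c" using cr a1 c by (intro frac_le) auto
  finally show "1 / 2 ^ k \<le> cmod z" unfolding e[symmetric] by (rule power2_le_imp_le) simp
  have "of_int a / of_int c \<le> real_of_int a / 1" using a c by (intro divide_left_mono) auto
  also have "\<dots> \<le> 2 ^ (2 * k + 1)" using ar by simp
  also have "\<dots> \<le> 2 ^ (2 * (k + 1))" by (rule power_increasing) auto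
  also have "\<dots> = (2 ^ (k + 1))\<^sup>2" by (simp add: power_mult[symmetric] mult.commute)
  finally show "cmod z \<le> 2 ^ (k + 1)" unfolding e[symmetric] by (rule power2_le_imp_le) simp
qed

text \<open>The squared moduli are distinct rationals with denominators at most
  \<open>2 ^ (2 * k)\<close>, so they differ by at least \<open>1 / 2 ^ (4 * k)\<close>. Dividing by
  the sum of the moduli, at most \<open>2 ^ (k + 2)\<close>, gives the claim.\<close>

lemma gauss_frac_cmod_separation:
  assumes "gauss_frac k v" "gauss_frac k w" "v \<noteq> 0" "w \<noteq> 0" "cmod v \<noteq> cmod w"
  shows "1 / 2 ^ (5 * k + 2) \<le> \<bar>cmod v - cmod w\<bar>"
proof -
  obtain a c :: int where c: "0 < c" "c \<le> 2 ^ (2 * k)" and e: "(cmod v)\<^sup>2 = of_int a / of_int c"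
    using gauss_frac_cmod_sq[OF assms(1)] .
  obtain a' c' :: int where c': "0 < c'" "c' \<le> 2 ^ (2 * k)" and e': "(cmod w)\<^sup>2 = of_int a' / of_int c'"
    using gauss_frac_cmod_sq[OF assms(2)] .
  have "(cmod v)\<^sup>2 \<noteq> (cmod w)\<^sup>2" using assms(5) by simp
  then have "a * c' - a' * c \<noteq> 0" using c c' unfolding e e'
    by (auto simp: field_simps) (metis of_int_eq_iff of_int_mult)
  then have one: "1 \<le> \<bar>a * c' - a' * c\<bar>" by simp
  have "1 / 2 ^ (4 * k) \<le> 1 / (real_of_int c * real_of_int c')"
  proof -
    have "real_of_int c \<le> 2 ^ (2 * k)" "real_of_int c' \<le> 2 ^ (2 * k)"
      using c(2) c'(2) by (metis of_int_le_iff of_int_numeral of_int_power)+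
    then have "real_of_int c * real_of_int c' \<le> 2 ^ (2 * k) * 2 ^ (2 * k)"
      using c c' by (intro mult_mono) auto
    also have "\<dots> = 2 ^ (4 * k)" by (simp add: power_add[symmetric])
    finally show ?thesis using c c' by (intro divide_left_mono) auto
  qed
  also have "\<dots> \<le> \<bar>real_of_int (a * c' - a' * c)\<bar> / (real_of_int c * real_of_int c')"
    using one c c' by (intro divide_right_mono mult_nonneg_nonneg) linarith+
  also have "\<dots> = \<bar>(cmod v)\<^sup>2 - (cmod w)\<^sup>2\<bar>"
    unfolding e e' using c c' by (simp add: field_simps)
  also have "\<dots> = \<bar>cmod v - cmod w\<bar> * (cmod v + cmod w)"
    by (simp add: power2_eq_square square_diff_square_factored abs_mult mult.commute)
  also have "\<dots> \<le> \<bar>cmod v - cmod w\<bar> * 2 ^ (k + 2)"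
    using gauss_frac_cmod_bounds[OF assms(1,3)] gauss_frac_cmod_bounds[OF assms(2,4)]
    by (intro mult_left_mono) auto
  finally have le: "1 / 2 ^ (4 * k) / 2 ^ (k + 2) \<le> \<bar>cmod v - cmod w\<bar>"
    by (simp add: divide_le_eq mult_ac)
  have eq: "1 / 2 ^ (4 * k) / 2 ^ (k + 2) = 1 / (2::real) ^ (5 * k + 2)"
    by (simp add: power_add[symmetric])
  show ?thesis using le unfolding eq .
qed

text \<open>The real part is the logarithm of the modulus and contributes at most
  \<open>k + 1\<close>; the imaginary part is at most pi, hence at most 4, in absolute
  value.\<close>

lemma gauss_frac_cmod_Ln:
  assumes "gauss_frac k z" "z \<noteq> 0"
  shows "cmod (Ln z) \<le> real k + 5"
proof -
  have up: "ln (cmod z) \<le> real (k + 1)"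
  proof -
    have "ln (cmod z) \<le> ln (2 ^ (k + 1))" using gauss_frac_cmod_bounds[OF assms] assms(2) by simp
    also have "\<dots> = real (k + 1) * ln 2" by (subst ln_realpow) auto
    also have "\<dots> \<le> real (k + 1) * 1" using ln_le_minus_one[of 2] by (intro mult_left_mono) auto
    finally show ?thesis by simp
  qed
  have lo: "- real k \<le> ln (cmod z)"
  proof -
    have "- real k \<le> - (real k * ln 2)" using ln_le_minus_one[of 2] mult_left_mono[of "ln 2" 1 "real k"] by auto
    also have "\<dots> = ln (1 / 2 ^ k)" by (simp add: ln_div ln_realpow)
    also have "\<dots> \<le> ln (cmod z)" using gauss_frac_cmod_bounds[OF assms] assms(2)
      by (subst ln_le_cancel_iff) auto
    finally show ?thesis .
  qed
  have "cmod (Ln z) \<le> \<bar>Re (Ln z)\<bar> + \<bar>Im (Ln z)\<bar>" by (rule cmod_le)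
  also have "\<bar>Re (Ln z)\<bar> \<le> real k + 1" using up lo assms(2) by (simp add: Re_Ln)
  also have "\<bar>Im (Ln z)\<bar> \<le> 4"
    using mpi_less_Im_Ln[OF assms(2)] Im_Ln_le_pi[OF assms(2)] pi_less_4 by linarith
  finally show ?thesis by simp
qed

lemma gauss_frac_one: "gauss_frac 0 1"
  unfolding gauss_frac_def
  by (rule exI[of _ 1], rule exI[of _ 0], rule exI[of _ 1]) (simp add: complex_eq_iff)

lemma gauss_frac_minus_one: "gauss_frac 0 (-1)"
  unfolding gauss_frac_def
  by (rule exI[of _ "-1"], rule exI[of _ 0], rule exI[of _ 1]) (simp add: complex_eq_iff)

section \<open>Lower bounds from linear forms in logarithms\<close>

text \<open>Follows from \<open>fact m \<le> m ^ m\<close> and \<open>m < 2 ^ m\<close> for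
  \<open>m = Suc n\<close>. The exponent is polynomial in \<open>n\<close> and
  \<open>B\<close>.\<close>

lemma fact_mult_power_two_le: "fact (Suc n) * (2 ^ B) ^ n \<le> (2::int) ^ ((n + 1) * (n + 1) + B * n)"
proof -
  have "(fact (Suc n) :: int) \<le> of_nat (Suc n ^ Suc n)" by (rule fact_le_power)
  also have "\<dots> \<le> of_nat ((2 ^ Suc n) ^ Suc n)"
    using power_mono[OF less_imp_le[OF less_exp[of "Suc n"]], of "Suc n"]
    by (simp only: of_nat_le_iff le0)
  also have "\<dots> = 2 ^ ((n + 1) * (n + 1))" by (simp add: power_add power_mult)
  finally have "fact (Suc n) * (2 ^ B) ^ n \<le> 2 ^ ((n + 1) * (n + 1)) * (2::int) ^ (B * n)"
    unfolding power_mult by (intro mult_right_mono) auto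
  then show ?thesis by (simp only: power_add)
qed

lemma ex_small_kernel_vector_bits:
  fixes x :: "nat \<Rightarrow> complex"
  assumes "M \<in> int_mats d n B"
    and "\<not> (\<exists>s. \<forall>j<n. x j = (\<Sum>i<d. of_int (M i j) * s i))"
  obtains h :: "nat \<Rightarrow> int" where
    "\<And>i. i < d \<Longrightarrow> (\<Sum>j<n. M i j * h j) = 0"
    "\<And>j. j < n \<Longrightarrow> \<bar>h j\<bar> \<le> 2 ^ ((n + 1) * (n + 1) + B * n)"
    "(\<Sum>j<n. of_int (h j) * x j) \<noteq> 0"
proof -
  have bd: "\<bar>M i j\<bar> \<le> 2 ^ B" if "i < d" "j < n" for i j
    using assms(1) that abs_le_of_int_bits[of "M i j" B] by (auto simp: int_mats_def)
  obtain h where "\<And>i. i < d \<Longrightarrow> (\<Sum>j<n. M i j * h j) = 0"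
    "\<And>j. j < n \<Longrightarrow> \<bar>h j\<bar> \<le> fact (Suc n) * (2 ^ B) ^ n"
    "(\<Sum>j<n. of_int (h j) * x j) \<noteq> 0"
    using small_kernel_vector[of "2 ^ B" d n M x, OF _ bd assms(2)] by auto
  then show thesis using order_trans[OF _ fact_mult_power_two_le] by (intro that[of h]) blast+
qed

text \<open>
  If \<open>z\<close> is not of the form \<open>exp (M\<^sup>T s)\<close>, then for every choice of branches \<open>x\<close> of the logarithms of
  \<open>z\<close> some small kernel vector \<open>h\<close> of \<open>M\<close> does not annihilate \<open>x\<close>. The number \<open>\<langle>h, x\<rangle> = \<langle>h, y\<rangle>\<close> is a
  linear form in logarithms, where multiples of \<open>2\<pi>i\<close> are expressed through \<open>Ln (-1)\<close>. Their
  coefficient is small because otherwise the linear form is trivially large.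
\<close>

lemma log_separation:
  assumes NT: "number_theoretic_hypothesis_on A" and minus1: "-1 \<in> A"
  shows "\<exists>C. \<forall>d n B b M z s y. M \<in> int_mats d n B \<longrightarrow>
      (\<forall>j<n. z j \<in> gauss_rats - {0} \<and> z j \<in> A \<and> gauss_bits (z j) \<le> b) \<longrightarrow>
      (\<forall>j<n. exp (y j) = z j * exp (\<Sum>i<d. of_int (M i j) * s i)) \<longrightarrow>
      \<not> (\<exists>s. \<forall>j<n. z j = exp (\<Sum>i<d. of_int (M i j) * s i)) \<longrightarrow>
      (\<exists>j<n. exp (- (real (2 + d + n + b + B) ^ C)) \<le> cmod (y j))"
proof -
  obtain C0 where C0: "\<And>n v e b B.
      (\<forall>j<n. v j \<in> gauss_rats - {0} \<and> v j \<in> A \<and> gauss_bits (v j) \<le> b \<and> int_bits (e j) \<le> B) \<Longrightarrow>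
      log_form n v e \<noteq> 0 \<Longrightarrow> exp (- (real (2 + n + b + B) ^ C0)) \<le> cmod (log_form n v e)"
    using NT unfolding number_theoretic_hypothesis_on_iff by blast
  \<comment> \<open>The hypothesis will be applied to a form of total size at most
    \<open>X ^ 9\<close>, which gives \<open>9 * C0\<close>. The additional 4 absorbs the loss from
    the entries of \<open>h\<close> and from summing \<open>n\<close> terms.\<close>
  have bound: "\<exists>j<n. exp (- (real (2 + d + n + b + B) ^ (9 * C0 + 4))) \<le> cmod (y j)"
    if M: "M \<in> int_mats d n B"
      and z: "\<And>j. j < n \<Longrightarrow> z j \<in> gauss_rats - {0} \<and> z j \<in> A \<and> gauss_bits (z j) \<le> b"
      and y: "\<And>j. j < n \<Longrightarrow> exp (y j) = z j * exp (\<Sum>i<d. of_int (M i j) * s i)"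
      and ns: "\<not> (\<exists>s. \<forall>j<n. z j = exp (\<Sum>i<d. of_int (M i j) * s i))"
    for d n B b M z s y
  proof (rule ccontr)
    assume contra: "\<not> ?thesis"
    define X where "X = 2 + d + n + b + B"
    define \<epsilon> where "\<epsilon> = exp (- (real X ^ (9 * C0 + 4)))"
    have small: "cmod (y j) \<le> \<epsilon>" if "j < n" for j
      using contra that by (auto simp: X_def \<epsilon>_def not_le intro: less_imp_le)
    \<comment> \<open>\<open>2 ^ L\<close> bounds the entries of the kernel vector, and
      \<open>2 ^ (L + N)\<close> will bound the coefficient of \<open>Ln (-1)\<close>.\<close>
    define L where "L = (n + 1) * (n + 1) + B * n"
    define N where "N = 1 + n * (b + 5)"
    have X2: "2 \<le> X" by (simp add: X_def)
    have "L \<le> (n + 1) * (n + 1 + B)" by (simp add: L_def algebra_simps)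
    also have "\<dots> \<le> X * X" by (intro mult_mono) (auto simp: X_def)
    finally have L_le: "L \<le> X ^ 2" by (simp add: power2_eq_square)
    have eight: "8 \<le> X ^ 3" using power_mono[OF X2, of 3] by simp
    have four: "4 \<le> X ^ 2" using power_mono[OF X2, of 2] by simp
    have bits_le: "2 + Suc n + (b + 6) + Suc (L + N) \<le> X ^ 9"
    proof -
      have "b + 5 \<le> X + X ^ 3" using eight by (simp add: X_def)
      also have "\<dots> \<le> X ^ 3 + X ^ 3" using X2 by (simp add: self_le_power)
      also have "\<dots> \<le> X * X ^ 3" by (simp only: mult_2[symmetric] mult_le_mono1 X2)
      also have "\<dots> = X ^ 4" by (simp add: power_numeral_reduce)
      finally have "n * (b + 5) \<le> X * X ^ 4" by (intro mult_mono) (auto simp: X_def)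
      then have "n * (b + 5) \<le> X ^ 5" by (simp add: power_numeral_reduce)
      moreover have "X ^ 2 \<le> X ^ 7" "X ^ 3 \<le> X ^ 7" "X ^ 5 \<le> X ^ 7" "X \<le> X ^ 7"
        using X2 by (auto intro: power_increasing self_le_power)
      moreover have "2 + n + b \<le> X" by (simp add: X_def)
      moreover have "9 \<le> X ^ 7" using power_mono[OF X2, of 7] by simp
      ultimately have "2 + Suc n + (b + 6) + Suc (L + N) \<le> 4 * X ^ 7"
        using L_le unfolding N_def by linarith
      also have "\<dots> \<le> X ^ 2 * X ^ 7" using four by (intro mult_right_mono) auto
      also have "\<dots> = X ^ 9" by (simp flip: power_add)
      finally show ?thesis .
    qed
    have "\<exists>k :: int. y j = Ln (z j) + (\<Sum>i<d. of_int (M i j) * s i) + of_int (2 * k) * of_real pi * \<i>"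
      if "j < n" for j
    proof -
      have "exp (y j) = exp (Ln (z j) + (\<Sum>i<d. of_int (M i j) * s i))"
        using y[OF that] z[OF that] by (simp add: exp_add)
      then show ?thesis unfolding exp_eq by auto
    qed
    then obtain k :: "nat \<Rightarrow> int" where k: "\<And>j. j < n \<Longrightarrow>
        y j = Ln (z j) + (\<Sum>i<d. of_int (M i j) * s i) + of_int (2 * k j) * of_real pi * \<i>"
      by metis
    \<comment> \<open>This is the branch of the logarithm of \<open>z\<close> for which
      \<open>y\<close> is exactly \<open>x\<close> plus the combination of the rows of
      \<open>M\<close> with coefficients \<open>s\<close>.\<close>
    define x where "x j = Ln (z j) + of_int (2 * k j) * of_real pi * \<i>" for j
    have exp_x: "exp (x j) = z j" if "j < n" for j
    proof -
      have "exp (x j) = exp (Ln (z j))" unfolding exp_eq x_def by (intro exI[of _ "k j"]) simp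
      then show ?thesis using z[OF that] by simp
    qed
    have "\<not> (\<exists>s. \<forall>j<n. x j = (\<Sum>i<d. of_int (M i j) * s i))"
      using ns exp_x by metis
    then obtain h where ker: "\<And>i. i < d \<Longrightarrow> (\<Sum>j<n. M i j * h j) = 0"
      and h_bd: "\<And>j. j < n \<Longrightarrow> \<bar>h j\<bar> \<le> 2 ^ L"
      and nz: "(\<Sum>j<n. of_int (h j) * x j) \<noteq> 0"
      using ex_small_kernel_vector_bits[OF M] unfolding L_def by blast
    define \<Lambda> where "\<Lambda> = (\<Sum>j<n. of_int (h j) * x j)"
    have h_bd': "cmod (of_int (h j)) \<le> 2 ^ L" if "j < n" for j
    proof -
      have "real_of_int \<bar>h j\<bar> \<le> of_int (2 ^ L)" using h_bd[OF that] by (simp only: of_int_le_iff)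
      then show ?thesis by simp
    qed
    \<comment> \<open>The orbit direction is annihilated by \<open>h\<close>, so \<open>h\<close>
      takes the same value on \<open>x\<close> and on \<open>y\<close>.\<close>
    have "(\<Sum>j<n. of_int (h j) * (\<Sum>i<d. of_int (M i j) * s i)) = (\<Sum>i<d. s i * of_int (\<Sum>j<n. M i j * h j))"
      unfolding of_int_sum sum_distrib_left by (subst sum.swap) (simp add: mult_ac)
    also have "\<dots> = 0" using ker by simp
    finally have \<Lambda>_y: "\<Lambda> = (\<Sum>j<n. of_int (h j) * y j)"
      by (simp add: \<Lambda>_def x_def k algebra_simps sum.distrib)
    define m where "m = (\<Sum>j<n. h j * k j)"
    \<comment> \<open>One more coordinate \<open>-1\<close> with coefficient \<open>2 * m\<close>
      supplies the multiple of \<open>2\<pi>i\<close> in \<open>\<Lambda>\<close>, as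
      \<open>Ln (-1) = \<i> * pi\<close>.\<close>
    define v' where "v' j = (if j < n then z j else -1)" for j
    define e' where "e' j = (if j < n then h j else 2 * m)" for j
    have \<Lambda>_split: "\<Lambda> = (\<Sum>j<n. of_int (h j) * Ln (z j)) + of_int (2 * m) * (\<i> * of_real pi)"
      by (simp add: \<Lambda>_def x_def m_def algebra_simps sum.distrib sum_distrib_left)
    have form: "log_form (Suc n) v' e' = \<Lambda>"
      unfolding log_form_def \<Lambda>_split by (simp add: v'_def e'_def)
    have lower: "exp (- (real X ^ (9 * C0))) \<le> cmod \<Lambda>"
    \<comment> \<open>If \<open>\<Lambda>\<close> is small, then \<open>2 * m * pi\<close> is within
      1 of the modulus of the principal part, which bounds \<open>m\<close>.\<close>
    proof (cases "1 \<le> cmod \<Lambda>")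
      case True
      have "exp (- (real X ^ (9 * C0))) \<le> 1" by simp
      with True show ?thesis by linarith
    next
      case False
      have "cmod (\<Sum>j<n. of_int (h j) * Ln (z j)) \<le> (\<Sum>j<n. 2 ^ L * (real b + 5))"
      proof (rule order_trans[OF norm_sum], rule sum_mono)
        fix j assume "j \<in> {..<n}"
        then have j: "j < n" by simp
        have "gauss_frac b (z j)" using z[OF j] by (intro gauss_frac_of_gauss_bits) auto
        then have "cmod (Ln (z j)) \<le> real b + 5" using z[OF j] by (intro gauss_frac_cmod_Ln) auto
        then show "cmod (of_int (h j) * Ln (z j)) \<le> 2 ^ L * (real b + 5)"
          unfolding norm_mult using h_bd'[OF j] by (intro mult_mono) auto
      qed
      then have "cmod (of_int (2 * m) * (\<i> * of_real pi)) \<le> 1 + real n * (2 ^ L * (real b + 5))"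
        using False \<Lambda>_split norm_triangle_ineq4[of \<Lambda> "\<Sum>j<n. of_int (h j) * Ln (z j)"] by simp
      also have "cmod (of_int (2 * m) * (\<i> * of_real pi)) = \<bar>real_of_int (2 * m)\<bar> * pi"
        unfolding norm_mult norm_of_int by simp
      finally have "\<bar>real_of_int (2 * m)\<bar> * pi \<le> 1 + real n * (2 ^ L * (real b + 5))" .
      moreover have "\<bar>real_of_int (2 * m)\<bar> * 1 \<le> \<bar>real_of_int (2 * m)\<bar> * pi"
        using pi_gt3 by (intro mult_left_mono) auto
      moreover have "1 + real n * (2 ^ L * (real b + 5)) \<le> 2 ^ L * real N"
        by (simp add: N_def algebra_simps)
      moreover have "2 ^ L * real N < 2 ^ L * 2 ^ N"
        using less_exp[of N] by (intro mult_strict_left_mono) (simp_all flip: of_nat_power_less_of_nat_cancel_iff)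
      ultimately have "\<bar>real_of_int (2 * m)\<bar> < 2 ^ (L + N)" unfolding power_add by linarith
      then have m_bd: "\<bar>2 * m\<bar> < 2 ^ (L + N)"
        by (metis of_int_abs of_int_less_iff of_int_numeral of_int_power)
      have "\<bar>h j\<bar> < 2 ^ (L + N)" if "j < n" for j
        using h_bd[OF that] power_strict_increasing[of L "L + N" "2::int"] by (simp add: N_def)
      then have "\<forall>j<Suc n. v' j \<in> gauss_rats - {0} \<and> v' j \<in> A \<and> gauss_bits (v' j) \<le> b + 6 \<and>
          int_bits (e' j) \<le> Suc (L + N)"
        unfolding int_bits_le_iff using z m_bd minus1 gauss_frac_imp_bits[OF gauss_frac_minus_one]
        by (auto simp: v'_def e'_def less_Suc_eq trans_le_add1)
      then have "exp (- (real (2 + Suc n + (b + 6) + Suc (L + N)) ^ C0)) \<le> cmod (log_form (Suc n) v' e')"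
        by (rule C0) (use nz form \<Lambda>_def in simp)
      moreover have "real (2 + Suc n + (b + 6) + Suc (L + N)) ^ C0 \<le> real (X ^ 9) ^ C0"
        using bits_le by (intro power_mono of_nat_mono) auto
      ultimately have "exp (- (real (X ^ 9) ^ C0)) \<le> cmod \<Lambda>"
        unfolding form by (smt (verit) exp_le_cancel_iff)
      then show ?thesis by (simp add: power_mult)
    qed
    \<comment> \<open>Expressed through the small numbers \<open>y j\<close>, the same form is at
      most \<open>n * 2 ^ L * \<epsilon>\<close>. Comparing exponents with \<open>lower\<close>
      leaves an inequality of natural numbers that fails for \<open>2 \<le> X\<close>.\<close>
    have "cmod \<Lambda> \<le> (\<Sum>j<n. 2 ^ L * \<epsilon>)"
      unfolding \<Lambda>_y
    proof (rule order_trans[OF norm_sum], rule sum_mono)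
      fix j assume "j \<in> {..<n}"
      then show "cmod (of_int (h j) * y j) \<le> 2 ^ L * \<epsilon>"
        unfolding norm_mult using h_bd' small by (intro mult_mono) auto
    qed
    also have "\<dots> = real n * 2 ^ L * \<epsilon>" by simp
    also have "\<dots> \<le> exp (real n) * exp (real L) * \<epsilon>"
    proof -
      have "real n \<le> exp (real n)" using exp_ge_add_one_self[of "real n"] by linarith
      moreover have "2 ^ L \<le> exp (real L)"
        using power_mono[of 2 "exp 1 :: real" L] exp_ge_add_one_self[of 1] by (simp flip: exp_of_nat_mult)
      ultimately show ?thesis by (intro mult_right_mono mult_mono) (auto simp: \<epsilon>_def)
    qed
    also have "\<dots> = exp (real n + real L - real X ^ (9 * C0 + 4))"
      by (simp add: \<epsilon>_def exp_add exp_diff exp_minus divide_inverse)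
    finally have "real X ^ (9 * C0 + 4) \<le> real (X ^ (9 * C0) + n + L)"
      using lower order_trans[OF lower] by fastforce
    then have "X ^ (9 * C0 + 4) \<le> X ^ (9 * C0) + n + L" by (simp only: of_nat_le_iff flip: of_nat_power)
    moreover have "X ^ (9 * C0) + n + L < X ^ (9 * C0 + 4)"
    proof -
      have a: "1 \<le> X ^ (9 * C0)" using X2 by simp
      have "n + L \<le> X ^ 2 + X ^ 2" using L_le self_le_power[of X 2] X2 by (simp add: X_def)
      also have "\<dots> \<le> X * X ^ 2" by (simp only: mult_2[symmetric] mult_le_mono1 X2)
      also have "\<dots> = X ^ 3" by (simp add: power_numeral_reduce)
      also have "\<dots> \<le> X ^ (9 * C0) * X ^ 3" using a by simp
      finally have "X ^ (9 * C0) + n + L \<le> X ^ (9 * C0) + X ^ (9 * C0) * X ^ 3" by simp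
      also have "\<dots> < X ^ (9 * C0) * X ^ 3 + X ^ (9 * C0) * X ^ 3" using a eight X2 by simp
      also have "\<dots> \<le> X ^ (9 * C0) * X ^ 3 * X" by (simp only: mult_2_right[symmetric] mult_le_mono2 X2)
      also have "\<dots> = X ^ (9 * C0 + 4)" by (simp add: power_add power_numeral_reduce)
      finally show ?thesis .
    qed
    ultimately show False by simp
  qed
  show ?thesis
  proof (rule exI[of _ "9 * C0 + 4"], intro allI impI)
    fix d n B b M z s y
    assume "M \<in> int_mats d n B" "\<forall>j<n. z j \<in> gauss_rats - {0} \<and> z j \<in> A \<and> gauss_bits (z j) \<le> b"
      "\<forall>j<n. exp (y j) = z j * exp (\<Sum>i<d. of_int (M i j) * s i)"
      "\<not> (\<exists>s. \<forall>j<n. z j = exp (\<Sum>i<d. of_int (M i j) * s i))"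
    then show "\<exists>j<n. exp (- (real (2 + d + n + b + B) ^ (9 * C0 + 4))) \<le> cmod (y j)"
      by (intro bound[where s = s and z = z and M = M]) blast+
  qed
qed

section \<open>Orbits and their distances\<close>

lemma prod_powi_eq_exp:
  fixes t :: "nat \<Rightarrow> complex"
  assumes "\<And>i. i < d \<Longrightarrow> t i \<noteq> 0"
  shows "(\<Prod>i<d. t i powi m i) = exp (\<Sum>i<d. of_int (m i) * Ln (t i))"
proof -
  have "(\<Prod>i<d. t i powi m i) = (\<Prod>i<d. exp (of_int (m i) * Ln (t i)))"
    by (intro prod.cong refl) (use assms in \<open>simp flip: exp_power_int\<close>)
  also have "\<dots> = exp (\<Sum>i<d. of_int (m i) * Ln (t i))"
    by (rule exp_sum[symmetric]) simp
  finally show ?thesis .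
qed

text \<open>Acting by \<open>u\<close> on \<open>v\<close> is acting by \<open>t * u\<close> on
  \<open>w\<close>. The value set \<open>S\<close> of the torus coordinates is left open so that
  both tori are covered.\<close>

lemma torus_act_image_subset:
  assumes mult: "\<And>a b. a \<in> S \<Longrightarrow> b \<in> S \<Longrightarrow> a * b \<in> S"
    and t: "t \<in> {..<d} \<rightarrow>\<^sub>E S"
    and v: "\<And>j. j < n \<Longrightarrow> v j = w j * (\<Prod>i<d. t i powi M i j)"
  shows "(\<lambda>t. torus_act d n M t v) ` ({..<d} \<rightarrow>\<^sub>E S) \<subseteq> (\<lambda>t. torus_act d n M t w) ` ({..<d} \<rightarrow>\<^sub>E S)"
proof (rule image_subsetI)
  fix u assume u: "u \<in> {..<d} \<rightarrow>\<^sub>E S"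
  let ?tu = "\<lambda>i\<in>{..<d}. t i * u i"
  have "?tu \<in> {..<d} \<rightarrow>\<^sub>E S" using t u mult by (auto simp: PiE_iff)
  moreover have "torus_act d n M u v = torus_act d n M ?tu w"
    by (auto simp: torus_act_def v power_int_mult_distrib prod.distrib mult.assoc)
  ultimately show "torus_act d n M u v \<in> (\<lambda>t. torus_act d n M t w) ` ({..<d} \<rightarrow>\<^sub>E S)" by blast
qed

lemma torus_act_image_eqI:
  assumes mult: "\<And>a b. a \<in> S \<Longrightarrow> b \<in> S \<Longrightarrow> a * b \<in> S" and inv: "\<And>a. a \<in> S \<Longrightarrow> inverse a \<in> S"
    and nz: "0 \<notin> S" and t: "t \<in> {..<d} \<rightarrow>\<^sub>E S"
    and v: "\<And>j. j < n \<Longrightarrow> v j = w j * (\<Prod>i<d. t i powi M i j)"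
  shows "(\<lambda>t. torus_act d n M t v) ` ({..<d} \<rightarrow>\<^sub>E S) = (\<lambda>t. torus_act d n M t w) ` ({..<d} \<rightarrow>\<^sub>E S)"
proof (rule antisym)
  show "(\<lambda>t. torus_act d n M t v) ` ({..<d} \<rightarrow>\<^sub>E S) \<subseteq> (\<lambda>t. torus_act d n M t w) ` ({..<d} \<rightarrow>\<^sub>E S)"
    by (rule torus_act_image_subset[OF mult t v])
  let ?t = "\<lambda>i\<in>{..<d}. inverse (t i)"
  have t_nz: "t i \<noteq> 0" if "i < d" for i
    using PiE_mem[OF t, of i] nz that by (metis lessThan_iff)
  show "(\<lambda>t. torus_act d n M t w) ` ({..<d} \<rightarrow>\<^sub>E S) \<subseteq> (\<lambda>t. torus_act d n M t v) ` ({..<d} \<rightarrow>\<^sub>E S)"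
  proof (rule torus_act_image_subset[OF mult])
    show "?t \<in> {..<d} \<rightarrow>\<^sub>E S" using t inv by (auto simp: PiE_iff)
    fix j assume "j < n"
    have "(\<Prod>i<d. ?t i powi M i j) = inverse (\<Prod>i<d. t i powi M i j)"
      by (simp add: power_int_inverse flip: prod_inversef)
    moreover have "(\<Prod>i<d. t i powi M i j) \<noteq> 0" using t_nz by simp
    ultimately show "w j = v j * (\<Prod>i<d. ?t i powi M i j)" using v[OF \<open>j < n\<close>] by simp
  qed
qed

lemma orbit_T_eqI:
  assumes "\<And>j. j < n \<Longrightarrow> v j = w j * exp (\<Sum>i<d. of_int (M i j) * s i)"
  shows "orbit_T d n M v = orbit_T d n M w"
  unfolding orbit_T_def torus_def
proof (rule torus_act_image_eqI[where t = "\<lambda>i\<in>{..<d}. exp (s i)"])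
  fix j assume "j < n"
  then show "v j = w j * (\<Prod>i<d. (\<lambda>i\<in>{..<d}. exp (s i)) i powi M i j)"
    using assms by (simp add: exp_sum exp_power_int)
qed auto

text \<open>Equality of moduli forces the real part of every exponent sum to vanish, so the
  imaginary parts of \<open>s\<close> alone define an element of the compact torus with the same
  effect.\<close>

lemma orbit_K_eqI:
  assumes v: "\<And>j. j < n \<Longrightarrow> v j = w j * exp (\<Sum>i<d. of_int (M i j) * s i)"
    and c: "\<And>j. j < n \<Longrightarrow> cmod (v j) = cmod (w j)" and nz: "\<And>j. j < n \<Longrightarrow> w j \<noteq> 0"
  shows "orbit_K d n M v = orbit_K d n M w"
  unfolding orbit_K_def compact_torus_def
proof (rule torus_act_image_eqI[where t = "\<lambda>i\<in>{..<d}. exp (\<i> * of_real (Im (s i)))"])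
  fix j assume j: "j < n"
  let ?S = "\<Sum>i<d. of_int (M i j) * s i"
  have "cmod (w j) * exp (Re ?S) = cmod (w j) * 1"
    using c[OF j] v[OF j] by (metis mult.right_neutral norm_exp_eq_Re norm_mult)
  then have "Re ?S = 0" using nz[OF j] by simp
  then have "?S = (\<Sum>i<d. of_int (M i j) * (\<i> * of_real (Im (s i))))"
    by (auto simp: complex_eq_iff Re_sum Im_sum)
  then show "v j = w j * (\<Prod>i<d. (\<lambda>i\<in>{..<d}. exp (\<i> * of_real (Im (s i)))) i powi M i j)"
    using v[OF j] by (simp add: exp_sum exp_power_int)
qed (auto simp: norm_mult norm_inverse)

lemma orbit_elemE:
  assumes "x \<in> (\<lambda>t. torus_act d n M t v) ` ({..<d} \<rightarrow>\<^sub>E S)" "0 \<notin> S"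
  obtains s where "\<And>j. j < n \<Longrightarrow> x j = v j * exp (\<Sum>i<d. of_int (M i j) * s i)"
proof -
  from assms(1) obtain t where t: "t \<in> {..<d} \<rightarrow>\<^sub>E S" and x: "x = torus_act d n M t v" by blast
  have "t i \<noteq> 0" if "i < d" for i
    using PiE_mem[OF t, of i] assms(2) that by (metis lessThan_iff)
  then have "x j = v j * exp (\<Sum>i<d. of_int (M i j) * Ln (t i))" if "j < n" for j
    using that by (simp add: x torus_act_def prod_powi_eq_exp)
  then show thesis by (rule that)
qed

lemma orbit_T_elemE:
  assumes "x \<in> orbit_T d n M v"
  obtains s where "\<And>j. j < n \<Longrightarrow> x j = v j * exp (\<Sum>i<d. of_int (M i j) * s i)"
  using assms orbit_elemE[of x d n M v "UNIV - {0}"] unfolding orbit_T_def torus_def by auto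

lemma orbit_K_elemE:
  assumes "x \<in> orbit_K d n M v"
  obtains s where "\<And>j. j < n \<Longrightarrow> x j = v j * exp (\<Sum>i<d. of_int (M i j) * s i)"
  using assms orbit_elemE[of x d n M v "sphere 0 1"] unfolding orbit_K_def compact_torus_def by auto

lemma cmod_orbit_K:
  assumes "x \<in> orbit_K d n M v" "j < n"
  shows "cmod (x j) = cmod (v j)"
proof -
  from assms obtain t where t: "t \<in> {..<d} \<rightarrow>\<^sub>E sphere 0 1" and x: "x = torus_act d n M t v"
    unfolding orbit_K_def compact_torus_def by blast
  have "cmod (t i) = 1" if "i < d" for i using t that by (auto simp: PiE_iff)
  then show ?thesis using assms(2) by (simp add: x torus_act_def norm_mult prod_norm[symmetric] norm_power_int)
qed

lemma orbit_nonempty: "orbit_T d n M v \<noteq> {}" "orbit_K d n M v \<noteq> {}"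
proof -
  have "torus_act d n M (\<lambda>i\<in>{..<d}. 1) v \<in> orbit_T d n M v"
    unfolding orbit_T_def torus_def by (intro imageI PiE_I) auto
  then show "orbit_T d n M v \<noteq> {}" by blast
  have "torus_act d n M (\<lambda>i\<in>{..<d}. 1) v \<in> orbit_K d n M v"
    unfolding orbit_K_def compact_torus_def by (intro imageI PiE_I) auto
  then show "orbit_K d n M v \<noteq> {}" by blast
qed

lemma self_in_orbit:
  assumes "v \<in> extensional {..<n}"
  shows "v \<in> orbit_T d n M v" "v \<in> orbit_K d n M v"
proof -
  have v: "v = torus_act d n M (\<lambda>i\<in>{..<d}. 1) v"
    using assms by (auto simp: torus_act_def extensional_def)
  have "torus_act d n M (\<lambda>i\<in>{..<d}. 1) v \<in> orbit_T d n M v"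
    unfolding orbit_T_def torus_def by (intro imageI PiE_I) auto
  then show "v \<in> orbit_T d n M v" using v by simp
  have "torus_act d n M (\<lambda>i\<in>{..<d}. 1) v \<in> orbit_K d n M v"
    unfolding orbit_K_def compact_torus_def by (intro imageI PiE_I) auto
  then show "v \<in> orbit_K d n M v" using v by simp
qed

section \<open>Estimates for the distances and their infima\<close>

lemma log_dist_nonneg: "0 \<le> log_dist n v w"
  unfolding log_dist_def by (rule cINF_greatest) (auto intro: L2_set_nonneg)

lemma euclid_dist_nonneg: "0 \<le> euclid_dist n v w"
  unfolding euclid_dist_def by (rule L2_set_nonneg)

lemma set_dist_le:
  assumes "\<And>x y. 0 \<le> \<delta> x y" "x \<in> X" "y \<in> Y"
  shows "set_dist \<delta> X Y \<le> \<delta> x y"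
  unfolding set_dist_def
  by (rule cINF_lower2[where x = "(x, y)"]) (use assms in \<open>auto intro!: bdd_belowI[of _ 0]\<close>)

lemma set_dist_ge:
  assumes "X \<noteq> {}" "Y \<noteq> {}" "\<And>x y. x \<in> X \<Longrightarrow> y \<in> Y \<Longrightarrow> c \<le> \<delta> x y"
  shows "c \<le> set_dist \<delta> X Y"
  unfolding set_dist_def by (rule cINF_greatest) (use assms in auto)

text \<open>Passing to the quotients \<open>v j / w j\<close> raises the bit-length bound to
  \<open>12 * b + 10\<close>, at the cost of a factor 5 in the exponent.\<close>

lemma poly_bound_ratio:
  fixes d n b B :: nat
  shows "real (2 + d + n + (12 * b + 10) + B) ^ C \<le> real (2 + d + n + b + B) ^ (5 * C)"
proof -
  define X where "X = 2 + d + n + b + B"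
  have "2 + d + n + (12 * b + 10) + B \<le> 16 * X" by (simp add: X_def)
  also have "\<dots> \<le> X ^ 4 * X"
    using power_mono[of 2 X 4] by (intro mult_right_mono) (auto simp: X_def)
  also have "\<dots> = X ^ 5" by (simp add: power_numeral_reduce)
  finally have "real (2 + d + n + (12 * b + 10) + B) ^ C \<le> real (X ^ 5) ^ C"
    by (intro power_mono of_nat_mono) auto
  then show ?thesis unfolding X_def by (simp only: of_nat_power power_mult)
qed

lemma gauss_vecsD:
  assumes "v \<in> gauss_vecs n b" "j < n"
  shows "v j \<in> gauss_rats" "v j \<noteq> 0" "gauss_bits (v j) \<le> b"
  using assms by (auto simp: gauss_vecs_def PiE_iff)

section \<open>Separation of orbits\<close>

text \<open>For points of the two orbits and any branch, the difference \<open>y\<close> of the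
  logarithms exponentiates to \<open>v / w\<close> times a torus element. Applying
  \<open>log_separation\<close> to \<open>v / w\<close> bounds some coordinate of \<open>y\<close>
  from below.\<close>

lemma nt_imp_algebraic_separation:
  assumes "number_theoretic_hypothesis_on UNIV"
  shows "algebraic_separation_hypothesis"
proof -
  obtain C where C: "\<forall>d n B b M z s y. M \<in> int_mats d n B \<longrightarrow>
      (\<forall>j<n. z j \<in> gauss_rats - {0} \<and> z j \<in> UNIV \<and> gauss_bits (z j) \<le> b) \<longrightarrow>
      (\<forall>j<n. exp (y j) = z j * exp (\<Sum>i<d. of_int (M i j) * s i)) \<longrightarrow>
      \<not> (\<exists>s. \<forall>j<n. z j = exp (\<Sum>i<d. of_int (M i j) * s i)) \<longrightarrow>
      (\<exists>j<n. exp (- (real (2 + d + n + b + B) ^ C)) \<le> cmod (y j))"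
    using log_separation[OF assms UNIV_I] by blast
  have "ereal (exp (- (real (2 + d + n + b + B) ^ (5 * C)))) \<le> sep_T d n B b" for d n B b
    unfolding sep_T_def
  proof (rule INF_greatest, clarify, unfold ereal_less_eq(3), rule set_dist_ge)
    fix M v w x x'
    assume M: "M \<in> int_mats d n B" and v: "v \<in> gauss_vecs n b" and w: "w \<in> gauss_vecs n b"
      and ne: "orbit_T d n M v \<noteq> orbit_T d n M w"
      and x: "x \<in> orbit_T d n M v" and x': "x' \<in> orbit_T d n M w"
    obtain s where s: "\<And>j. j < n \<Longrightarrow> x j = v j * exp (\<Sum>i<d. of_int (M i j) * s i)"
      using orbit_T_elemE[OF x] by blast
    obtain s' where s': "\<And>j. j < n \<Longrightarrow> x' j = w j * exp (\<Sum>i<d. of_int (M i j) * s' i)"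
      using orbit_T_elemE[OF x'] by blast
    show "exp (- (real (2 + d + n + b + B) ^ (5 * C))) \<le> log_dist n x x'"
      unfolding log_dist_def
    proof (rule cINF_greatest)
      fix k :: "nat \<Rightarrow> int"
      define y where "y j = Ln (x j) - Ln (x' j) - 2 * of_real pi * \<i> * of_int (k j)" for j
      have "\<exists>j<n. exp (- (real (2 + d + n + (12 * b + 10) + B) ^ C)) \<le> cmod (y j)"
      proof (rule C[rule_format, OF M, where z = "\<lambda>j. v j / w j" and y = y and s = "\<lambda>i. s i - s' i"])
        show "v j / w j \<in> gauss_rats - {0} \<and> v j / w j \<in> UNIV \<and> gauss_bits (v j / w j) \<le> 12 * b + 10"
          if "j < n" for j
          using gauss_bits_divide[of "v j" b "w j"] gauss_vecsD[OF v that] gauss_vecsD[OF w that] by auto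
        show "exp (y j) = v j / w j * exp (\<Sum>i<d. of_int (M i j) * (s i - s' i))" if "j < n" for j
        proof -
          have "exp (2 * of_real pi * \<i> * of_int (k j)) = 1"
            using exp_integer_2pi[of "of_int (k j)"] by (simp add: mult_ac)
          then have "exp (y j) = x j / x' j"
            using s[OF that] s'[OF that] gauss_vecsD[OF v that] gauss_vecsD[OF w that]
            by (simp add: y_def exp_diff)
          then show ?thesis
            by (simp add: s[OF that] s'[OF that] right_diff_distrib sum_subtractf exp_diff)
        qed
        show "\<not> (\<exists>s. \<forall>j<n. v j / w j = exp (\<Sum>i<d. of_int (M i j) * s i))"
        proof
          assume "\<exists>s. \<forall>j<n. v j / w j = exp (\<Sum>i<d. of_int (M i j) * s i)"
          then obtain r where "\<forall>j<n. v j / w j = exp (\<Sum>i<d. of_int (M i j) * r i)" by blast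
          then have "orbit_T d n M v = orbit_T d n M w"
            using gauss_vecsD(2)[OF w] by (intro orbit_T_eqI[where s = r]) (auto simp: field_simps)
          with ne show False by simp
        qed
      qed
      then obtain j where j: "j < n" "exp (- (real (2 + d + n + (12 * b + 10) + B) ^ C)) \<le> cmod (y j)"
        by blast
      have "exp (- (real (2 + d + n + b + B) ^ (5 * C))) \<le> exp (- (real (2 + d + n + (12 * b + 10) + B) ^ C))"
        using poly_bound_ratio[of d n b B C] by (simp only: exp_le_cancel_iff neg_le_iff_le)
      also have "\<dots> \<le> cmod (y j)" by (rule j(2))
      also have "\<dots> \<le> L2_set (\<lambda>j. cmod (y j)) {..<n}" using j(1) by (intro member_le_L2_set) auto
      finally show "exp (- (real (2 + d + n + b + B) ^ (5 * C))) \<le>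
          L2_set (\<lambda>j. cmod (Ln (x j) - Ln (x' j) - 2 * of_real pi * \<i> * of_int (k j))) {..<n}"
        by (simp only: y_def)
    qed simp
  qed (rule orbit_nonempty)+
  then show ?thesis
    unfolding algebraic_separation_hypothesis_def ex_eval4_bound_iff by blast
qed

text \<open>Near 1 the power series of the logarithm gives the factor 2. Elsewhere the logarithm is
  at most 4 in modulus, while \<open>cmod (u - 1)\<close> is at least 1/2; this gives the 8.\<close>

lemma cmod_Ln_le_unit:
  assumes "cmod u = 1"
  shows "cmod (Ln u) \<le> 8 * cmod (u - 1)"
proof (cases "cmod (u - 1) < 1 / 2")
  case True
  then have "cmod (Ln (1 + (u - 1))) \<le> 2 * cmod (u - 1)" by (intro norm_Ln_le) auto
  then have "cmod (Ln u) \<le> 2 * cmod (u - 1)" by simp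
  then show ?thesis using norm_ge_zero[of "u - 1"] by linarith
next
  case False
  have "u \<noteq> 0" using assms by auto
  then have "cmod (Ln u) \<le> 4"
    using cmod_le[of "Ln u"] assms mpi_less_Im_Ln[of u] Im_Ln_le_pi[of u] pi_less_4 by (simp add: Re_Ln)
  with False show ?thesis by simp
qed

lemma inverse_power_two_ge: "exp (- real m) \<le> 1 / 2 ^ m"
proof -
  have "2 ^ m \<le> exp (real m)"
    using power_mono[of 2 "exp 1 :: real" m] exp_ge_add_one_self[of 1] by (simp flip: exp_of_nat_mult)
  then show ?thesis by (simp add: exp_minus inverse_eq_divide divide_left_mono)
qed

text \<open>If some moduli differ, the compact torus preserves the gap between them. Otherwise
  \<open>v / w\<close> is unimodular, so the restricted hypothesis applies, and
  \<open>cmod_Ln_le_unit\<close> carries its bound over to Euclidean distance.\<close>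

lemma nt_unit_imp_compact_separation:
  assumes "number_theoretic_hypothesis_on {z. cmod z = 1}"
  shows "compact_separation_hypothesis"
proof -
  have "-1 \<in> {z :: complex. cmod z = 1}" by simp
  then obtain C where C: "\<forall>d n B b M z s y. M \<in> int_mats d n B \<longrightarrow>
      (\<forall>j<n. z j \<in> gauss_rats - {0} \<and> z j \<in> {z. cmod z = 1} \<and> gauss_bits (z j) \<le> b) \<longrightarrow>
      (\<forall>j<n. exp (y j) = z j * exp (\<Sum>i<d. of_int (M i j) * s i)) \<longrightarrow>
      \<not> (\<exists>s. \<forall>j<n. z j = exp (\<Sum>i<d. of_int (M i j) * s i)) \<longrightarrow>
      (\<exists>j<n. exp (- (real (2 + d + n + b + B) ^ C)) \<le> cmod (y j))"
    using log_separation[OF assms] by blast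
  have "ereal (exp (- (real (2 + d + n + b + B) ^ (5 * C + 4)))) \<le> sep_K d n B b" for d n B b
    unfolding sep_K_def
  proof (rule INF_greatest, clarify, unfold ereal_less_eq(3), rule set_dist_ge)
    fix M v w x x'
    assume M: "M \<in> int_mats d n B" and v: "v \<in> gauss_vecs n b" and w: "w \<in> gauss_vecs n b"
      and ne: "orbit_K d n M v \<noteq> orbit_K d n M w"
      and x: "x \<in> orbit_K d n M v" and x': "x' \<in> orbit_K d n M w"
    define X where "X = 2 + d + n + b + B"
    have X2: "2 \<le> X" by (simp add: X_def)
    have frac: "gauss_frac b (v j)" "gauss_frac b (w j)" if "j < n" for j
      using gauss_vecsD[OF v that] gauss_vecsD[OF w that] by (auto intro: gauss_frac_of_gauss_bits)
    have "\<exists>j<n. exp (- (real X ^ (5 * C + 4))) \<le> cmod (x j - x' j)"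
    proof (cases "\<exists>j<n. cmod (v j) \<noteq> cmod (w j)")
      case True
      then obtain j where j: "j < n" "cmod (v j) \<noteq> cmod (w j)" by blast
      have "5 * b + 2 \<le> 8 * X" by (simp add: X_def)
      also have "\<dots> \<le> X ^ 3 * X" using power_mono[OF X2, of 3] by (intro mult_right_mono) auto
      also have "\<dots> = X ^ 4" by (simp add: power_numeral_reduce)
      also have "\<dots> \<le> X ^ (5 * C + 4)" using X2 by (intro power_increasing) auto
      finally have "real (5 * b + 2) \<le> real X ^ (5 * C + 4)" by (simp only: of_nat_le_iff flip: of_nat_power)
      then have "exp (- (real X ^ (5 * C + 4))) \<le> exp (- real (5 * b + 2))" by simp
      also have "\<dots> \<le> 1 / 2 ^ (5 * b + 2)" by (rule inverse_power_two_ge)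
      also have "\<dots> \<le> \<bar>cmod (v j) - cmod (w j)\<bar>"
        using gauss_frac_cmod_separation[OF frac[OF j(1)] _ _ j(2)]
          gauss_vecsD(2)[OF v j(1)] gauss_vecsD(2)[OF w j(1)] by blast
      also have "\<dots> = \<bar>cmod (x j) - cmod (x' j)\<bar>"
        using cmod_orbit_K[OF x j(1)] cmod_orbit_K[OF x' j(1)] by simp
      also have "\<dots> \<le> cmod (x j - x' j)" by (rule norm_triangle_ineq3)
      finally show ?thesis using j(1) by blast
    next
      case False
      then have eq: "cmod (v j) = cmod (w j)" if "j < n" for j using that by blast
      obtain s where s: "\<And>j. j < n \<Longrightarrow> x j = v j * exp (\<Sum>i<d. of_int (M i j) * s i)"
        using orbit_K_elemE[OF x] by blast
      obtain s' where s': "\<And>j. j < n \<Longrightarrow> x' j = w j * exp (\<Sum>i<d. of_int (M i j) * s' i)"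
        using orbit_K_elemE[OF x'] by blast
      \<comment> \<open>The principal logarithm of the quotient is the branch that
        \<open>cmod_Ln_le_unit\<close> controls.\<close>
      define y where "y j = Ln (x j / x' j)" for j
      have "\<exists>j<n. exp (- (real (2 + d + n + (12 * b + 10) + B) ^ C)) \<le> cmod (y j)"
      proof (rule C[rule_format, OF M, where z = "\<lambda>j. v j / w j" and y = y and s = "\<lambda>i. s i - s' i"])
        show "v j / w j \<in> gauss_rats - {0} \<and> v j / w j \<in> {z. cmod z = 1} \<and> gauss_bits (v j / w j) \<le> 12 * b + 10"
          if "j < n" for j
          using gauss_bits_divide[of "v j" b "w j"] gauss_vecsD[OF v that] gauss_vecsD[OF w that] eq[OF that]
          by (auto simp: norm_divide)
        show "exp (y j) = v j / w j * exp (\<Sum>i<d. of_int (M i j) * (s i - s' i))" if "j < n" for j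
          using gauss_vecsD[OF v that] gauss_vecsD[OF w that]
          by (simp add: y_def s[OF that] s'[OF that] right_diff_distrib sum_subtractf exp_diff)
        show "\<not> (\<exists>s. \<forall>j<n. v j / w j = exp (\<Sum>i<d. of_int (M i j) * s i))"
        proof
          assume "\<exists>s. \<forall>j<n. v j / w j = exp (\<Sum>i<d. of_int (M i j) * s i)"
          then obtain r where "\<forall>j<n. v j / w j = exp (\<Sum>i<d. of_int (M i j) * r i)" by blast
          then have "orbit_K d n M v = orbit_K d n M w"
            using gauss_vecsD(2)[OF w] eq by (intro orbit_K_eqI[where s = r]) (auto simp: field_simps)
          with ne show False by simp
        qed
      qed
      then obtain j where j: "j < n" "exp (- (real (2 + d + n + (12 * b + 10) + B) ^ C)) \<le> cmod (y j)"
        by blast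
      have cx: "cmod (x j) = cmod (w j)" "cmod (x' j) = cmod (w j)"
        using cmod_orbit_K[OF x j(1)] cmod_orbit_K[OF x' j(1)] eq[OF j(1)] by auto
      have w0: "w j \<noteq> 0" using gauss_vecsD(2)[OF w j(1)] .
      then have x'0: "x' j \<noteq> 0" using cx by auto
      \<comment> \<open>The surplus 4 pays for the factor \<open>2 ^ (b + 3)\<close>: 8 comes from
        \<open>cmod_Ln_le_unit\<close>, and \<open>2 ^ b\<close> from the lower bound
        \<open>1 / 2 ^ b\<close> for \<open>cmod (x' j)\<close>.\<close>
      have "X ^ (5 * C) + (b + 3) \<le> X ^ (5 * C + 4)"
      proof -
        have a: "1 \<le> X ^ (5 * C)" using X2 by simp
        have "b + 3 \<le> X + X" using X2 by (simp add: X_def)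
        also have "\<dots> \<le> X * X" by (simp only: mult_2[symmetric] mult_le_mono1 X2)
        also have "\<dots> \<le> X ^ 3" using X2 by (simp add: power_numeral_reduce)
        also have "\<dots> \<le> X ^ (5 * C) * X ^ 3" using a by simp
        finally have "X ^ (5 * C) + (b + 3) \<le> X ^ (5 * C) * X ^ 3 + X ^ (5 * C) * X ^ 3"
          using X2 by (intro add_mono) auto
        also have "\<dots> \<le> X ^ (5 * C) * X ^ 3 * X" by (simp only: mult_2_right[symmetric] mult_le_mono2 X2)
        also have "\<dots> = X ^ (5 * C + 4)" by (simp add: power_add power_numeral_reduce)
        finally show ?thesis .
      qed
      then have "real (X ^ (5 * C) + (b + 3)) \<le> real (X ^ (5 * C + 4))" by (simp only: of_nat_le_iff)
      then have "exp (- (real X ^ (5 * C + 4))) \<le> exp (- real (b + 3) + - (real X ^ (5 * C)))" by simp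
      also have "\<dots> = exp (- real (b + 3)) * exp (- (real X ^ (5 * C)))" by (rule exp_add)
      also have "\<dots> \<le> 1 / 2 ^ (b + 3) * cmod (y j)"
      proof (intro mult_mono inverse_power_two_ge)
        have "exp (- (real X ^ (5 * C))) \<le> exp (- (real (2 + d + n + (12 * b + 10) + B) ^ C))"
          unfolding X_def using poly_bound_ratio[of d n b B C] by (simp only: exp_le_cancel_iff neg_le_iff_le)
        with j(2) show "exp (- (real X ^ (5 * C))) \<le> cmod (y j)" by linarith
      qed auto
      also have "\<dots> \<le> 1 / 2 ^ (b + 3) * (8 * cmod (x j / x' j - 1))"
        unfolding y_def using cx w0 by (intro mult_left_mono cmod_Ln_le_unit) (auto simp: norm_divide)
      also have "\<dots> = 1 / 2 ^ b * cmod (x j / x' j - 1)" by (simp add: power_add)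
      also have "\<dots> \<le> cmod (x' j) * cmod (x j / x' j - 1)"
        unfolding cx(2) using gauss_frac_cmod_bounds(1)[OF frac(2)[OF j(1)] w0] by (intro mult_right_mono) auto
      also have "\<dots> = cmod (x j - x' j)" unfolding norm_mult[symmetric] using x'0 by (simp add: right_diff_distrib)
      finally show ?thesis using j(1) by blast
    qed
    then obtain j where j: "j < n" "exp (- (real X ^ (5 * C + 4))) \<le> cmod (x j - x' j)" by blast
    note j(2)
    also have "cmod (x j - x' j) \<le> euclid_dist n x x'"
      unfolding euclid_dist_def using j(1) by (intro member_le_L2_set) auto
    finally show "exp (- (real (2 + d + n + b + B) ^ (5 * C + 4))) \<le> euclid_dist n x x'"
      unfolding X_def .
  qed (rule orbit_nonempty)+
  then show ?thesis
    unfolding compact_separation_hypothesis_def ex_eval4_bound_iff by blast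
qed

lemma Ln_exp_small:
  assumes "cmod z < 1"
  shows "Ln (exp z) = z"
  using abs_Im_le_cmod[of z] assms pi_gt3 by (intro Ln_exp) auto

section \<open>Linear forms as orbit distances\<close>

text \<open>
  The rows of \<open>M\<close> span the orthogonal complement of \<open>e\<close>, so that a torus element moves all coordinates
  of \<open>v\<close> to \<open>1\<close> except for one, which becomes \<open>exp (\<Lambda> / q)\<close> with \<open>q\<close> a nonzero coefficient of the linear
  form \<open>\<Lambda>\<close>.
\<close>

lemma log_form_to_orbit:
  assumes v: "\<And>j. j < n \<Longrightarrow> v j \<noteq> 0" and e: "\<And>j. j < n \<Longrightarrow> int_bits (e j) \<le> B"
    and nz: "log_form n v e \<noteq> 0" and lt1: "cmod (log_form n v e) < 1"
  shows "\<exists>M l q. M \<in> int_mats n n B \<and> l < n \<and> q \<noteq> 0 \<and>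
    (\<forall>j<n. v j * exp (\<Sum>i<n. of_int (M i j) * (- Ln (v i) / of_int q)) =
       (if j = l then exp (log_form n v e / of_int q) else 1)) \<and>
    \<not> (\<exists>s. \<forall>j<n. v j = exp (\<Sum>i<n. of_int (M i j) * s i))"
proof -
  have "\<exists>l<n. e l \<noteq> 0"
  proof (rule ccontr)
    assume "\<not> ?thesis"
    then have "log_form n v e = 0" unfolding log_form_def by (intro sum.neutral) auto
    with nz show False by simp
  qed
  then obtain l where l: "l < n" and q0: "e l \<noteq> 0" by blast
  define q where "q = e l"
  \<comment> \<open>Row \<open>i\<close> has \<open>q\<close> at position \<open>i\<close> and
    \<open>- e i\<close> at position \<open>l\<close>, hence is orthogonal to \<open>e\<close>. At
    \<open>i = j = l\<close> the two terms cancel, so every entry is, up to sign, 0 or a coefficient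
    of the form and no bits are added.\<close>
  define M where "M i j = (if j = i then q else 0) - (if j = l then e i else 0)" for i j
  have bits: "M \<in> int_mats n n B"
  proof -
    have "int_bits (M i j) \<le> B" if "i < n" "j < n" for i j
    proof -
      have "M i j = 0 \<or> \<bar>M i j\<bar> = \<bar>e l\<bar> \<or> \<bar>M i j\<bar> = \<bar>e i\<bar>" by (auto simp: M_def q_def)
      moreover have "int_bits 0 \<le> int_bits (e l)" by (simp add: int_bits_def)
      ultimately show ?thesis
        using int_bits_abs_eq[of "M i j" "e l"] int_bits_abs_eq[of "M i j" "e i"] e[OF l] e[OF that(1)] by auto
    qed
    then show ?thesis by (simp add: int_mats_def)
  qed
  have col: "(\<Sum>i<n. of_int (M i j) * s i) = of_int q * s j - (if j = l then (\<Sum>i<n. of_int (e i) * s i) else 0)"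
    if "j < n" for j and s :: "nat \<Rightarrow> complex"
  proof -
    have "(\<Sum>i<n. of_int (M i j) * s i) =
        (\<Sum>i<n. if i = j then of_int q * s i else 0) - (\<Sum>i<n. if j = l then of_int (e i) * s i else 0)"
      unfolding sum_subtractf[symmetric] by (intro sum.cong) (auto simp: M_def algebra_simps)
    then show ?thesis using that by simp
  qed
  have row: "(\<Sum>j<n. e j * M i j) = 0" if "i < n" for i
  proof -
    have "(\<Sum>j<n. e j * M i j) = (\<Sum>j<n. if j = i then e j * q else 0) - (\<Sum>j<n. if j = l then e j * e i else 0)"
      unfolding sum_subtractf[symmetric] by (intro sum.cong) (auto simp: M_def algebra_simps)
    then show ?thesis using that l by (simp add: q_def)
  qed
  have move: "v j * exp (\<Sum>i<n. of_int (M i j) * (- Ln (v i) / of_int q)) =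
       (if j = l then exp (log_form n v e / of_int q) else 1)" if "j < n" for j
  proof -
    have "(\<Sum>i<n. of_int (M i j) * (- Ln (v i) / of_int q)) =
        - Ln (v j) + (if j = l then log_form n v e / of_int q else 0)"
      unfolding col[OF that] using q0 by (simp add: q_def log_form_def sum_divide_distrib sum_negf)
    then show ?thesis using v[OF that] by (cases "j = l") (simp_all only: exp_add exp_minus, simp_all)
  qed
  have "\<not> (\<exists>s. \<forall>j<n. v j = exp (\<Sum>i<n. of_int (M i j) * s i))"
  proof
    assume "\<exists>s. \<forall>j<n. v j = exp (\<Sum>i<n. of_int (M i j) * s i)"
    then obtain s where s: "\<And>j. j < n \<Longrightarrow> v j = exp (\<Sum>i<n. of_int (M i j) * s i)" by blast
    \<comment> \<open>The monomial with exponents \<open>e\<close> is invariant under the torus. If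
      \<open>v\<close> lay in the orbit of the ones, it would equal 1 at \<open>v\<close>, and a
      form of modulus below 1 would have to vanish.\<close>
    have "exp (log_form n v e) = (\<Prod>j<n. v j powi e j)"
      unfolding log_form_def by (rule prod_powi_eq_exp[symmetric]) (use v in auto)
    also have "\<dots> = (\<Prod>j<n. exp (of_int (e j) * (\<Sum>i<n. of_int (M i j) * s i)))"
      by (intro prod.cong refl) (simp add: s exp_power_int)
    also have "\<dots> = exp (\<Sum>j<n. of_int (e j) * (\<Sum>i<n. of_int (M i j) * s i))"
      by (simp add: exp_sum)
    also have "(\<Sum>j<n. of_int (e j) * (\<Sum>i<n. of_int (M i j) * s i)) = (\<Sum>i<n. s i * of_int (\<Sum>j<n. e j * M i j))"
      unfolding of_int_sum sum_distrib_left by (subst sum.swap) (simp add: mult_ac)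
    also have "\<dots> = 0" using row by simp
    finally have "Ln (exp (log_form n v e)) = 0" by simp
    then show False using nz Ln_exp_small[OF lt1] by simp
  qed
  then show ?thesis using bits l q0 move by (intro exI[of _ M] exI[of _ l] exI[of _ q]) (auto simp: q_def)
qed

text \<open>Here \<open>d = n\<close> and the bit-length is \<open>b + 6\<close>, the size of the
  orbit instance built from a linear form.\<close>

lemma poly_bound_square:
  fixes n b B :: nat
  shows "real (2 + n + n + (b + 6) + B) ^ C \<le> real (2 + n + b + B) ^ (4 * C)"
proof -
  define X where "X = 2 + n + b + B"
  have "2 + n + n + (b + 6) + B \<le> 8 * X" by (simp add: X_def)
  also have "\<dots> \<le> X ^ 3 * X"
    using power_mono[of 2 X 3] by (intro mult_right_mono) (auto simp: X_def)
  also have "\<dots> = X ^ 4" by (simp add: power_numeral_reduce)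
  finally have "real (2 + n + n + (b + 6) + B) ^ C \<le> real (X ^ 4) ^ C"
    by (intro power_mono of_nat_mono) auto
  then show ?thesis unfolding X_def by (simp only: of_nat_power power_mult)
qed

lemma log_form_restrict: "log_form n (restrict v {..<n}) e = log_form n v e"
  by (simp add: log_form_def)

text \<open>The 6 is the bound of \<open>gauss_frac_imp_bits\<close> for \<open>k = 0\<close>; it
  puts the ones into the same set as the given vector, whatever \<open>b\<close> is.\<close>

lemma ones_in_gauss_vecs: "(\<lambda>j\<in>{..<n}. 1) \<in> gauss_vecs n (b + 6)"
  using gauss_frac_imp_bits[OF gauss_frac_one] by (auto simp: gauss_vecs_def)

lemma restrict_in_gauss_vecs:
  assumes "\<And>j. j < n \<Longrightarrow> v j \<in> gauss_rats - {0} \<and> gauss_bits (v j) \<le> b"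
  shows "restrict v {..<n} \<in> gauss_vecs n (b + 6)"
  using assms by (auto simp: gauss_vecs_def trans_le_add1)

lemma cmod_divide_int_le:
  assumes "q \<noteq> 0"
  shows "cmod (z / of_int q) \<le> cmod z"
proof -
  have "1 \<le> q \<or> q \<le> -1" using assms by linarith
  then have "1 \<le> \<bar>real_of_int q\<bar>" by auto
  then show ?thesis by (simp add: norm_divide divide_le_eq mult_le_cancel_left1)
qed

text \<open>A form of modulus at least 1 satisfies the bound trivially. Otherwise the orbits of
  \<open>v\<close> and of the ones are distinct and contain \<open>?x\<close> and
  \<open>?one\<close>, at logarithmic distance at most
  \<open>cmod (\<Lambda> / of_int q)\<close>.\<close>

lemma algebraic_separation_imp_nt:
  assumes "algebraic_separation_hypothesis"
  shows "number_theoretic_hypothesis_on UNIV"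
proof -
  obtain C where C: "\<And>d n B b. ereal (exp (- (real (2 + d + n + b + B) ^ C))) \<le> sep_T d n B b"
    using assms unfolding algebraic_separation_hypothesis_def ex_eval4_bound_iff by blast
  have "exp (- (real (2 + n + b + B) ^ (4 * C))) \<le> cmod (log_form n v0 e)"
    if v0: "\<forall>j<n. v0 j \<in> gauss_rats - {0} \<and> v0 j \<in> UNIV \<and> gauss_bits (v0 j) \<le> b \<and> int_bits (e j) \<le> B"
      and nz0: "log_form n v0 e \<noteq> 0" for n v0 e b B
  proof (cases "cmod (log_form n v0 e) < 1")
    case False
    moreover have "exp (- (real (2 + n + b + B) ^ (4 * C))) \<le> 1" by simp
    ultimately show ?thesis by linarith
  next
    case True
    define v where "v = restrict v0 {..<n}"
    define \<Lambda> where "\<Lambda> = log_form n v e"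
    have \<Lambda>: "\<Lambda> = log_form n v0 e" by (simp add: \<Lambda>_def v_def log_form_restrict)
    have v: "v \<in> gauss_vecs n (b + 6)" unfolding v_def using v0 by (intro restrict_in_gauss_vecs) auto
    have e: "int_bits (e j) \<le> B" if "j < n" for j using v0 that by simp
    have nz: "log_form n v e \<noteq> 0" and lt1: "cmod (log_form n v e) < 1"
      using nz0 True \<Lambda> by (simp_all add: \<Lambda>_def)
    obtain M l q where M: "M \<in> int_mats n n B" and l: "l < n" and q: "q \<noteq> 0"
      and move: "\<forall>j<n. v j * exp (\<Sum>i<n. of_int (M i j) * (- Ln (v i) / of_int q)) =
         (if j = l then exp (\<Lambda> / of_int q) else 1)"
      and ns: "\<not> (\<exists>s. \<forall>j<n. v j = exp (\<Sum>i<n. of_int (M i j) * s i))"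
      using log_form_to_orbit[OF gauss_vecsD(2)[OF v] e nz lt1, folded \<Lambda>_def] by blast
    let ?one = "\<lambda>j\<in>{..<n}. 1 :: complex"
    let ?x = "\<lambda>j\<in>{..<n}. if j = l then exp (\<Lambda> / of_int q) else 1"
    have ne: "orbit_T n n M v \<noteq> orbit_T n n M ?one"
    proof
      assume eq: "orbit_T n n M v = orbit_T n n M ?one"
      have "v \<in> orbit_T n n M ?one"
        unfolding eq[symmetric] by (rule self_in_orbit) (simp add: v_def)
      then obtain s where "\<And>j. j < n \<Longrightarrow> v j = ?one j * exp (\<Sum>i<n. of_int (M i j) * s i)"
        using orbit_T_elemE by blast
      with ns show False by auto
    qed
    have "?x \<in> orbit_T n n M v"
    proof -
      have "?x \<in> orbit_T n n M ?x" by (rule self_in_orbit) simp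
      also have "orbit_T n n M ?x = orbit_T n n M v"
        by (rule orbit_T_eqI[where s = "\<lambda>i. - Ln (v i) / of_int q"]) (use move in simp)
      finally show ?thesis .
    qed
    moreover have "?one \<in> orbit_T n n M ?one" by (rule self_in_orbit) simp
    ultimately have "set_dist (log_dist n) (orbit_T n n M v) (orbit_T n n M ?one) \<le> log_dist n ?x ?one"
      by (intro set_dist_le log_dist_nonneg)
    \<comment> \<open>The branch \<open>k = 0\<close> bounds the infimum; it recovers
      \<open>\<Lambda> / of_int q\<close> because that number has modulus below 1.\<close>
    also have "\<dots> \<le> L2_set (\<lambda>j. cmod (Ln (?x j) - Ln (?one j) - 2 * of_real pi * \<i> * of_int 0)) {..<n}"
      unfolding log_dist_def
      by (rule cINF_lower2[where x = "\<lambda>_. 0"]) (auto intro!: bdd_belowI[of _ 0] L2_set_nonneg)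
    also have "\<dots> \<le> (\<Sum>j<n. cmod (Ln (?x j) - Ln (?one j) - 2 * of_real pi * \<i> * of_int 0))"
      by (rule L2_set_le_sum) simp
    also have "\<dots> = (\<Sum>j<n. if j = l then cmod (\<Lambda> / of_int q) else 0)"
    proof (intro sum.cong refl)
      have "cmod (\<Lambda> / of_int q) < 1"
        by (rule le_less_trans[OF cmod_divide_int_le[OF q]]) (use True \<Lambda> in simp)
      then have "Ln (exp (\<Lambda> / of_int q)) = \<Lambda> / of_int q" by (rule Ln_exp_small)
      then show "cmod (Ln (?x j) - Ln (?one j) - 2 * of_real pi * \<i> * of_int 0) =
          (if j = l then cmod (\<Lambda> / of_int q) else 0)" if "j \<in> {..<n}" for j using that by simp
    qed
    also have "\<dots> = cmod (\<Lambda> / of_int q)" using l by simp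
    also have "\<dots> \<le> cmod \<Lambda>" by (rule cmod_divide_int_le[OF q])
    finally have le: "set_dist (log_dist n) (orbit_T n n M v) (orbit_T n n M ?one) \<le> cmod \<Lambda>" .
    have "exp (- (real (2 + n + b + B) ^ (4 * C))) \<le> exp (- (real (2 + n + n + (b + 6) + B) ^ C))"
      using poly_bound_square[of n b B C] by (simp only: exp_le_cancel_iff neg_le_iff_le)
    also have "ereal \<dots> \<le> sep_T n n B (b + 6)" by (rule C)
    also have "\<dots> \<le> ereal (set_dist (log_dist n) (orbit_T n n M v) (orbit_T n n M ?one))"
      unfolding sep_T_def
      by (rule INF_lower2[where i = "(M, v, ?one)"]) (use M v ones_in_gauss_vecs ne in auto)
    finally show ?thesis using le \<Lambda> by simp
  qed
  then show ?thesis unfolding number_theoretic_hypothesis_on_iff by blast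
qed

lemma compact_separation_imp_nt_unit:
  assumes "compact_separation_hypothesis"
  shows "number_theoretic_hypothesis_on {z. cmod z = 1}"
proof -
  obtain C where C: "\<And>d n B b. ereal (exp (- (real (2 + d + n + b + B) ^ C))) \<le> sep_K d n B b"
    using assms unfolding compact_separation_hypothesis_def ex_eval4_bound_iff by blast
  have "exp (- (real (2 + n + b + B) ^ (4 * C))) \<le> cmod (log_form n v0 e)"
    if v0: "\<forall>j<n. v0 j \<in> gauss_rats - {0} \<and> v0 j \<in> {z. cmod z = 1} \<and> gauss_bits (v0 j) \<le> b \<and> int_bits (e j) \<le> B"
      and nz0: "log_form n v0 e \<noteq> 0" for n v0 e b B
  proof (cases "cmod (log_form n v0 e) < 1")
    case False
    moreover have "exp (- (real (2 + n + b + B) ^ (4 * C))) \<le> 1" by simp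
    ultimately show ?thesis by linarith
  next
    case True
    define v where "v = restrict v0 {..<n}"
    define \<Lambda> where "\<Lambda> = log_form n v e"
    have \<Lambda>: "\<Lambda> = log_form n v0 e" by (simp add: \<Lambda>_def v_def log_form_restrict)
    have v: "v \<in> gauss_vecs n (b + 6)" unfolding v_def using v0 by (intro restrict_in_gauss_vecs) auto
    have unit: "cmod (v j) = 1" if "j < n" for j using v0 that by (simp add: v_def)
    have e: "int_bits (e j) \<le> B" if "j < n" for j using v0 that by simp
    have nz: "log_form n v e \<noteq> 0" and lt1: "cmod (log_form n v e) < 1"
      using nz0 True \<Lambda> by (simp_all add: \<Lambda>_def)
    obtain M l q where M: "M \<in> int_mats n n B" and l: "l < n" and q: "q \<noteq> 0"
      and move: "\<forall>j<n. v j * exp (\<Sum>i<n. of_int (M i j) * (- Ln (v i) / of_int q)) =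
         (if j = l then exp (\<Lambda> / of_int q) else 1)"
      and ns: "\<not> (\<exists>s. \<forall>j<n. v j = exp (\<Sum>i<n. of_int (M i j) * s i))"
      using log_form_to_orbit[OF gauss_vecsD(2)[OF v] e nz lt1, folded \<Lambda>_def] by blast
    \<comment> \<open>Logarithms of unimodular numbers are purely imaginary, hence so is
      \<open>\<Lambda> / of_int q\<close>. Thus \<open>?x\<close> is unimodular and is reached from
      \<open>v\<close> by the compact torus.\<close>
    have "Re (Ln (v j)) = 0" if "j < n" for j
      using unit[OF that] gauss_vecsD(2)[OF v that] by (simp add: Re_Ln)
    then have "Re \<Lambda> = 0" by (simp add: \<Lambda>_def log_form_def Re_sum)
    then have "Re (\<Lambda> / of_int q) = 0"
      using Re_divide_of_real[of \<Lambda> "of_int q"] by simp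
    then have im: "\<Lambda> / of_int q = \<i> * of_real (Im (\<Lambda> / of_int q))" by (simp add: complex_eq_iff)
    let ?one = "\<lambda>j\<in>{..<n}. 1 :: complex"
    let ?x = "\<lambda>j\<in>{..<n}. if j = l then exp (\<Lambda> / of_int q) else 1"
    have ne: "orbit_K n n M v \<noteq> orbit_K n n M ?one"
    proof
      assume eq: "orbit_K n n M v = orbit_K n n M ?one"
      have "v \<in> orbit_K n n M ?one"
        unfolding eq[symmetric] by (rule self_in_orbit) (simp add: v_def)
      then obtain s where "\<And>j. j < n \<Longrightarrow> v j = ?one j * exp (\<Sum>i<n. of_int (M i j) * s i)"
        using orbit_K_elemE by blast
      with ns show False by auto
    qed
    have "?x \<in> orbit_K n n M v"
    proof -
      have "cmod (exp (\<Lambda> / of_int q)) = 1" using \<open>Re (\<Lambda> / of_int q) = 0\<close> by (simp add: norm_exp_eq_Re)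
      have "?x \<in> orbit_K n n M ?x" by (rule self_in_orbit) simp
      also have "orbit_K n n M ?x = orbit_K n n M v"
        by (rule orbit_K_eqI[where s = "\<lambda>i. - Ln (v i) / of_int q"])
          (use move unit \<open>cmod (exp (\<Lambda> / of_int q)) = 1\<close> gauss_vecsD(2)[OF v] in simp_all)
      finally show ?thesis .
    qed
    moreover have "?one \<in> orbit_K n n M ?one" by (rule self_in_orbit) simp
    ultimately have "set_dist (euclid_dist n) (orbit_K n n M v) (orbit_K n n M ?one) \<le> euclid_dist n ?x ?one"
      by (intro set_dist_le euclid_dist_nonneg)
    also have "\<dots> \<le> (\<Sum>j<n. cmod (?x j - ?one j))"
      unfolding euclid_dist_def by (rule L2_set_le_sum) simp
    also have "\<dots> = (\<Sum>j<n. if j = l then cmod (exp (\<Lambda> / of_int q) - 1) else 0)"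
      by (intro sum.cong) auto
    also have "\<dots> = cmod (exp (\<Lambda> / of_int q) - 1)" using l by simp
    \<comment> \<open>A chord of the unit circle is at most as long as its arc.\<close>
    also have "\<dots> = 2 * \<bar>sin (Im (\<Lambda> / of_int q) / 2)\<bar>"
      by (subst im) (rule dist_exp_i_1)
    also have "\<dots> \<le> \<bar>Im (\<Lambda> / of_int q)\<bar>"
      using abs_sin_x_le_abs_x[of "Im (\<Lambda> / of_int q) / 2"] by simp
    also have "\<dots> \<le> cmod (\<Lambda> / of_int q)" by (rule abs_Im_le_cmod)
    also have "\<dots> \<le> cmod \<Lambda>" by (rule cmod_divide_int_le[OF q])
    finally have le: "set_dist (euclid_dist n) (orbit_K n n M v) (orbit_K n n M ?one) \<le> cmod \<Lambda>" .
    have "exp (- (real (2 + n + b + B) ^ (4 * C))) \<le> exp (- (real (2 + n + n + (b + 6) + B) ^ C))"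
      using poly_bound_square[of n b B C] by (simp only: exp_le_cancel_iff neg_le_iff_le)
    also have "ereal \<dots> \<le> sep_K n n B (b + 6)" by (rule C)
    also have "\<dots> \<le> ereal (set_dist (euclid_dist n) (orbit_K n n M v) (orbit_K n n M ?one))"
      unfolding sep_K_def
      by (rule INF_lower2[where i = "(M, v, ?one)"]) (use M v ones_in_gauss_vecs ne in auto)
    finally show ?thesis using le \<Lambda> by simp
  qed
  then show ?thesis unfolding number_theoretic_hypothesis_on_iff by blast
qed

theorem theorem1p6:
  "(algebraic_separation_hypothesis \<longleftrightarrow> number_theoretic_hypothesis) \<and>
   (compact_separation_hypothesis \<longleftrightarrow> number_theoretic_hypothesis_on {z. cmod z = 1})"
  unfolding number_theoretic_hypothesis_def
  using nt_imp_algebraic_separation algebraic_separation_imp_nt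
    nt_unit_imp_compact_separation compact_separation_imp_nt_unit by blast

end
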